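(* Let $B_1,\dots,B_s$ be the bouquets of $A=[\mathbf{a}_1,\dots,\mathbf{a}_n]\in\mathbb{Z}^{m\times n}$, and define $A_B=[\mathbf{a}_{B_1},\dots,\mathbf{a}_{B_s}]$. Let $S\subset\{1,\dots,s\}$ be the subset of coordinates corresponding to the mixed bouquets. Then the following are equivalent: (a) There exists no element in the Graver basis of $A_B$ which has a proper semiconformal decomposition that is conformal on the coordinates corresponding to $S$. (b) $I_A$ is strongly robust, i.e. the following sets coincide: the Graver basis of $A$, the universal Gröbner basis of $A$, any reduced Gröbner basis of $A$, any minimal Markov basis of $A$. (c) The toric ideal of $A_B$ is $S$-Lawrence.
   Context: For $A=[\mathbf{a}_1,\dots,\mathbf{a}_n]\in\mathbb{Z}^{m\times n}$ let $\operatorname{Ker}_{\mathbb{Z}}(A)=\{\mathbf{u}\in\mathbb{Z}^n:A\mathbf{u}=\mathbf{0}\}$. For an integer vector write $\mathbf{u}=\mathbf{u}^+-\mathbf{u}^-$ with $\mathbf{u}^{\pm}$ nonnegative of disjoint support. Over a field $K$, $I_A=(\mathbf{x}^{\mathbf{u}^+}-\mathbf{x}^{\mathbf{u}^-}:\mathbf{u}\in\operatorname{Ker}_{\mathbb{Z}}(A))\subset K[x_1,\dots,x_n]$ is the toric ideal of $A$. Gale transform: let $r=\operatorname{rank}A$, fix a basis $G_1,\dots,G_{n-r}$ of the lattice $\operatorname{Ker}_{\mathbb{Z}}(A)$, and let $G(\mathbf{a}_i)\in\mathbb{Z}^{n-r}$ be the $i$-th row of the matrix with columns $G_1,\dots,G_{n-r}$.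 Bouquets: a co-vector of $A$ is a vector $(\mathbf{v}\cdot\mathbf{a}_1,\dots,\mathbf{v}\cdot\mathbf{a}_n)$ with $\mathbf{v}\in\mathbb{Z}^m$; a co-circuit is a nonzero co-vector of minimal support. $\mathbf{a}_i$ is free if $\{i\}$ is the support of a co-circuit (equivalently $G(\mathbf{a}_i)=\mathbf{0}$). The bouquet graph $G_A$ has vertices $\mathbf{a}_1,\dots,\mathbf{a}_n$ (distinguished by their indices), and $\{\mathbf{a}_i,\mathbf{a}_j\}$, $i\neq j$, is an edge if there is a co-vector with support $\{i,j\}$. When such a co-vector is a co-circuit, the edge is in $E_A^+$ if its two nonzero coordinates have distinct signs and in $E_A^-$ if they have the same sign; the remaining edges join free vectors. The bouquets of $A$ are the connected components of $G_A$. The free vectors, if any, form one bouquet, the free bouquet; all others are non-free. A non-free bouquet is mixed if it contains an edge of $E_A^-$, and non-mixed if it is an isolated vertex or all its edges are in $E_A^+$. Vectors $\mathbf{c}_B$, $\mathbf{a}_B$: if $B$ is free, $\mathbf{c}_B\in\mathbb{Z}^n$ is any (fixed) vector with support $\{i:\mathbf{a}_i\in B\}$ and positive first nonzero coordinate. If $B$ is non-free, choose a coordinate $j$ with $G(\mathbf{a}_i)_j\neq0$ for all $\mathbf{a}_i\in B$ (these Gale vectors are nonzero and pairwise proportional), let $g_j=\gcd(G(\mathbf{a}_i)_j:\mathbf{a}_i\in B)$, let $i_0$ be the smallest index with $\mathbf{a}_{i_0}\in B$, let $\varepsilon$ be the sign of $G(\mathbf{a}_{i_0})_j$, and let $\mathbf{c}_B\in\mathbb{Z}^n$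 have $i$-th coordinate $\varepsilon G(\mathbf{a}_i)_j/g_j$ if $\mathbf{a}_i\in B$ and $0$ otherwise (independent of $j$). Set $\mathbf{a}_B=\sum_{i=1}^n(\mathbf{c}_B)_i\mathbf{a}_i$. Decompositions: let $\mathbf{u}=\mathbf{v}+\mathbf{w}$ with all three vectors in the integer kernel of a matrix. It is conformal if $\mathbf{u}^+=\mathbf{v}^++\mathbf{w}^+$ and $\mathbf{u}^-=\mathbf{v}^-+\mathbf{w}^-$; it is conformal on the coordinates in $S$ if these equalities hold for all coordinates $i\in S$ (no condition if $S=\emptyset$). It is semiconformal if, for every $i$, $v_i>0$ implies $w_i\ge0$, and $w_i<0$ implies $v_i\le0$. It is proper if $\mathbf{v},\mathbf{w}\ne\mathbf{0}$. The Graver basis of a matrix is the set of nonzero vectors in its integer kernel having no proper conformal decomposition. Bases (a kernel vector $\mathbf{u}$ is identified with $\mathbf{x}^{\mathbf{u}^+}-\mathbf{x}^{\mathbf{u}^-}$, and elements differing by a sign are identified): a Markov basis of $A$ is a finite subset of $\operatorname{Ker}_{\mathbb{Z}}(A)$ whose binomials generate $I_A$; it is minimal if no proper subset is a Markov basis. The universal Gröbner basis is the union of all reduced Gröbner bases of $I_A$. The set of indispensable binomials of $A$ is the intersection of all minimal Markov bases. $I_A$ is strongly robust if its set of indispensable binomials equals its Graver basis. $S$-Lawrence: let $C$ be an integer matrix with $s$ columns and $S\subset\{1,\dots,s\}$. For $\mathbf{u}\in\mathbb{Z}^s$, the $S$-part of $\mathbf{u}$ is $(u_i:i\in S)$ (it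 is $0$ if $S=\emptyset$), and $P_S(\mathbf{u})=\prod_{i\in S}[0,\max\{u_i^+,u_i^-\}]$, with $P_\emptyset(\mathbf{u})=\{0\}$. The fiber of $\mathbf{u}^+$ is $\{\mathbf{t}\in\mathbb{N}^s:\mathbf{u}^+-\mathbf{t}\in\operatorname{Ker}_{\mathbb{Z}}(C)\}$. The toric ideal $I_C$ is $S$-Lawrence if for every $\mathbf{u}$ in the Graver basis of $C$ there is no element $\mathbf{w}$ in the fiber of $\mathbf{u}^+$, different from $\mathbf{u}^+$ and $\mathbf{u}^-$, whose $S$-part belongs to $P_S(\mathbf{u})$. *)

theory Defs
  imports "HOL-Analysis.Analysis" "HOL-Library.Poly_Mapping"
begin

text \<open>
  A matrix \<open>A = [a\<^sub>1, \<dots>, a\<^sub>n]\<close> is a term of type \<^typ>\<open>int^'n^'m\<close>; its columns are indexed by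
  the finite type \<open>'n\<close> (linearly ordered where the order of the columns matters), and its \<open>i\<close>-th column \<open>a\<^sub>i\<close> is \<open>column i A\<close>.
\<close>

section \<open>Integer kernels and decompositions of kernel vectors\<close>

definition int_kernel :: "int^'n^'m \<Rightarrow> (int^'n) set" where
  "int_kernel A = {u. A *v u = 0}"

definition support :: "int^'n \<Rightarrow> 'n set" where
  "support u = {i. u $ i \<noteq> 0}"

definition pos_part :: "int^'n \<Rightarrow> nat^'n" where
  "pos_part u = (\<chi> i. nat (u $ i))"

definition neg_part :: "int^'n \<Rightarrow> nat^'n" where
  "neg_part u = (\<chi> i. nat (- (u $ i)))"

definition decomposition :: "int^'n^'m \<Rightarrow> int^'n \<Rightarrow> int^'n \<Rightarrow> int^'n \<Rightarrow> bool" where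
  "decomposition A u v w \<longleftrightarrow>
     u \<in> int_kernel A \<and> v \<in> int_kernel A \<and> w \<in> int_kernel A \<and> u = v + w"

definition proper_decomposition :: "int^'n^'m \<Rightarrow> int^'n \<Rightarrow> int^'n \<Rightarrow> int^'n \<Rightarrow> bool" where
  "proper_decomposition A u v w \<longleftrightarrow> decomposition A u v w \<and> v \<noteq> 0 \<and> w \<noteq> 0"

definition conformal_on :: "'n set \<Rightarrow> int^'n \<Rightarrow> int^'n \<Rightarrow> int^'n \<Rightarrow> bool" where
  "conformal_on S u v w \<longleftrightarrow>
     (\<forall>i\<in>S. pos_part u $ i = pos_part v $ i + pos_part w $ i \<and>
            neg_part u $ i = neg_part v $ i + neg_part w $ i)"

definition conformal :: "int^'n \<Rightarrow> int^'n \<Rightarrow> int^'n \<Rightarrow> bool" where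
  "conformal u v w \<longleftrightarrow>
     pos_part u = pos_part v + pos_part w \<and> neg_part u = neg_part v + neg_part w"

definition semiconformal :: "int^'n \<Rightarrow> int^'n \<Rightarrow> bool" where
  "semiconformal v w \<longleftrightarrow>
     (\<forall>i. (v $ i > 0 \<longrightarrow> w $ i \<ge> 0) \<and> (w $ i < 0 \<longrightarrow> v $ i \<le> 0))"

definition graver_basis :: "int^'n^'m \<Rightarrow> (int^'n) set" where
  "graver_basis A =
     {u \<in> int_kernel A. u \<noteq> 0 \<and> \<not> (\<exists>v w. proper_decomposition A u v w \<and> conformal u v w)}"


section \<open>Gale transforms\<close>

global_interpretation int_vec: module "(*s) :: int \<Rightarrow> int^'n \<Rightarrow> int^'n"
  by unfold_locales (simp_all add: vec_eq_iff algebra_simps)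

definition lattice_basis :: "(int^'n) set \<Rightarrow> (int^'n) list \<Rightarrow> bool" where
  "lattice_basis L Gs \<longleftrightarrow>
     distinct Gs \<and> int_vec.independent (set Gs) \<and> int_vec.span (set Gs) = L"

text \<open>
  If \<open>Gs\<close> is a basis of \<open>int_kernel A\<close> (so \<open>length Gs = n - rank A\<close>), then \<open>gale Gs i j\<close> is the
  \<open>j\<close>-th coordinate, \<open>j < length Gs\<close>, of the Gale vector \<open>G(a\<^sub>i)\<close>.
\<close>

definition gale :: "(int^'n) list \<Rightarrow> 'n \<Rightarrow> nat \<Rightarrow> int" where
  "gale Gs i j = (Gs ! j) $ i"


section \<open>Bouquets\<close>

definition covectors :: "int^'n^'m \<Rightarrow> (int^'n) set" where
  "covectors A = range (\<lambda>v. v v* A)"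

definition cocircuits :: "int^'n^'m \<Rightarrow> (int^'n) set" where
  "cocircuits A =
     {u \<in> covectors A. u \<noteq> 0 \<and>
        (\<forall>w\<in>covectors A. w \<noteq> 0 \<longrightarrow> support w \<subseteq> support u \<longrightarrow> support w = support u)}"

definition free_vectors :: "int^'n^'m \<Rightarrow> 'n set" where
  "free_vectors A = {i. \<exists>u\<in>cocircuits A. support u = {i}}"

definition bouquet_edges :: "int^'n^'m \<Rightarrow> ('n \<times> 'n) set" where
  "bouquet_edges A = {(i, j). i \<noteq> j \<and> (\<exists>u\<in>covectors A. support u = {i, j})}"

definition neg_edges :: "int^'n^'m \<Rightarrow> ('n \<times> 'n) set" where
  "neg_edges A =
     {(i, j). i \<noteq> j \<and> (\<exists>u\<in>cocircuits A. support u = {i, j} \<and> sgn (u $ i) = sgn (u $ j))}"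

text \<open>
  \<^const>\<open>bouquet_edges\<close> is symmetric, so the classes of its reflexive transitive closure are the
  connected components of the bouquet graph.
\<close>

definition bouquets :: "int^'n^'m \<Rightarrow> 'n set set" where
  "bouquets A = UNIV // (bouquet_edges A)\<^sup>*"

definition free_bouquet :: "int^'n^'m \<Rightarrow> 'n set \<Rightarrow> bool" where
  "free_bouquet A B \<longleftrightarrow> B \<in> bouquets A \<and> B = free_vectors A"

definition mixed_bouquet :: "int^'n^'m \<Rightarrow> 'n set \<Rightarrow> bool" where
  "mixed_bouquet A B \<longleftrightarrow>
     B \<in> bouquets A \<and> \<not> free_bouquet A B \<and> (\<exists>i\<in>B. \<exists>j\<in>B. (i, j) \<in> neg_edges A)"

text \<open>
  \<open>is_bouquet_vector A Gs B c\<close> states that \<open>c\<close> is an admissible choice of the vector \<open>c\<^sub>B\<close>; for a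
  non-free bouquet, \<open>j\<close> is the chosen coordinate, and the division by the gcd is exact.
\<close>

definition is_bouquet_vector ::
    "int^'n::{finite,linorder}^'m \<Rightarrow> (int^'n::{finite,linorder}) list \<Rightarrow> 'n set \<Rightarrow>
      int^'n::{finite,linorder} \<Rightarrow> bool" where
  "is_bouquet_vector A Gs B c \<longleftrightarrow>
     (if free_bouquet A B then support c = B \<and> c $ Min B > 0
      else (\<exists>j<length Gs. (\<forall>i\<in>B. gale Gs i j \<noteq> 0) \<and>
              c = (\<chi> i. if i \<in> B
                        then sgn (gale Gs (Min B) j) * (gale Gs i j div Gcd ((\<lambda>i. gale Gs i j) ` B))
                        else 0)))"

text \<open>The matrix with columns \<open>a\<^sub>B = \<Sum>\<^sub>i (c\<^sub>B)\<^sub>i a\<^sub>i\<close>, where \<open>c k\<close> is the vector of the \<open>k\<close>-th bouquet.\<close>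

definition bouquet_matrix :: "int^'n^'m \<Rightarrow> ('s \<Rightarrow> int^'n) \<Rightarrow> int^'s^'m" where
  "bouquet_matrix A c = (\<chi> r k. (\<Sum>i\<in>UNIV. (c k $ i) *s column i A) $ r)"


section \<open>The toric ideal\<close>

text \<open>
  The polynomial ring \<open>K[x\<^sub>1, \<dots>, x\<^sub>n]\<close> is the monoid algebra of the additive monoid \<^typ>\<open>nat^'n\<close> of
  exponent vectors; the product of \<^typ>\<open>'a \<Rightarrow>\<^sub>0 'b\<close> is convolution. As a module over itself, its
  submodule spanned by a set is the ideal generated by that set.
\<close>

type_synonym ('n, 'k) mpoly = "(nat^'n) \<Rightarrow>\<^sub>0 'k"

definition monomial :: "nat^'n \<Rightarrow> ('n, 'k::field) mpoly" where
  "monomial a = Poly_Mapping.single a 1"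

definition binomial_of :: "int^'n \<Rightarrow> ('n, 'k::field) mpoly" where
  "binomial_of u = monomial (pos_part u) - monomial (neg_part u)"

global_interpretation ideal: module "(*) :: 'a::comm_ring_1 \<Rightarrow> 'a \<Rightarrow> 'a"
  by unfold_locales (simp_all add: algebra_simps)

definition toric_ideal :: "int^'n^'m \<Rightarrow> ('n, 'k::field) mpoly set" where
  "toric_ideal A = ideal.span (binomial_of ` int_kernel A)"


section \<open>Groebner bases\<close>

definition monomial_order :: "(nat^'n) rel \<Rightarrow> bool" where
  "monomial_order r \<longleftrightarrow>
     linear_order r \<and> (\<forall>a. (0, a) \<in> r) \<and> (\<forall>a b c. (a, b) \<in> r \<longrightarrow> (a + c, b + c) \<in> r)"

definition lead_exp :: "(nat^'n) rel \<Rightarrow> ('n, 'k::field) mpoly \<Rightarrow> nat^'n" where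
  "lead_exp r p =
     (THE a. a \<in> Poly_Mapping.keys p \<and> (\<forall>b\<in>Poly_Mapping.keys p. (b, a) \<in> r))"

definition initial_ideal :: "(nat^'n) rel \<Rightarrow> ('n, 'k::field) mpoly set \<Rightarrow> ('n, 'k) mpoly set" where
  "initial_ideal r F = ideal.span ((\<lambda>p. monomial (lead_exp r p)) ` (F - {0}))"

definition groebner_basis ::
    "(nat^'n) rel \<Rightarrow> ('n, 'k::field) mpoly set \<Rightarrow> ('n, 'k) mpoly set \<Rightarrow> bool" where
  "groebner_basis r I G \<longleftrightarrow> finite G \<and> G \<subseteq> I \<and> initial_ideal r G = initial_ideal r I"

text \<open>
  On exponent vectors \<open>\<le>\<close> is the componentwise order, that is, divisibility of monomials. The
  condition on the leading coefficient excludes \<open>0 \<in> G\<close>.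
\<close>

definition reduced_groebner_basis ::
    "(nat^'n) rel \<Rightarrow> ('n, 'k::field) mpoly set \<Rightarrow> ('n, 'k) mpoly set \<Rightarrow> bool" where
  "reduced_groebner_basis r I G \<longleftrightarrow>
     groebner_basis r I G \<and>
     (\<forall>g\<in>G. Poly_Mapping.lookup g (lead_exp r g) = 1 \<and>
            (\<forall>h\<in>G - {g}. \<forall>a\<in>Poly_Mapping.keys g. \<not> lead_exp r h \<le> a))"

definition universal_groebner_basis ::
    "('n::finite, 'k::field) mpoly set \<Rightarrow> ('n::finite, 'k) mpoly set" where
  "universal_groebner_basis I =
     \<Union>{G. \<exists>r. monomial_order r \<and> reduced_groebner_basis r I G}"


section \<open>Markov bases and strong robustness\<close>

text \<open>The argument of type \<^typ>\<open>'k itself\<close> is the coefficient field.\<close>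

definition markov_basis :: "'k::field itself \<Rightarrow> int^'n^'m \<Rightarrow> (int^'n) set \<Rightarrow> bool" where
  "markov_basis K A M \<longleftrightarrow>
     finite M \<and> M \<subseteq> int_kernel A \<and>
     ideal.span (binomial_of ` M :: ('n, 'k) mpoly set) = toric_ideal A"

definition minimal_markov_basis :: "'k::field itself \<Rightarrow> int^'n^'m \<Rightarrow> (int^'n) set \<Rightarrow> bool" where
  "minimal_markov_basis K A M \<longleftrightarrow>
     markov_basis K A M \<and> (\<forall>N. N \<subset> M \<longrightarrow> \<not> markov_basis K A N)"

text \<open>
  Elements differing by a sign are identified, so sets are compared and intersected after
  closing them under negation.
\<close>

definition sign_closure :: "'a::uminus set \<Rightarrow> 'a set" where
  "sign_closure X = X \<union> uminus ` X"

definition eq_up_to_sign :: "'a::uminus set \<Rightarrow> 'a set \<Rightarrow> bool" where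
  "eq_up_to_sign X Y \<longleftrightarrow> sign_closure X = sign_closure Y"

definition indispensable :: "'k::field itself \<Rightarrow> int^'n^'m \<Rightarrow> (int^'n) set" where
  "indispensable K A = \<Inter>{sign_closure M |M. minimal_markov_basis K A M}"

definition strongly_robust :: "'k::field itself \<Rightarrow> int^'n^'m \<Rightarrow> bool" where
  "strongly_robust K A \<longleftrightarrow> eq_up_to_sign (indispensable K A) (graver_basis A)"

definition bases_coincide :: "'k::field itself \<Rightarrow> int^'n^'m \<Rightarrow> bool" where
  "bases_coincide K A \<longleftrightarrow>
     eq_up_to_sign (universal_groebner_basis (toric_ideal A :: ('n, 'k) mpoly set))
       (binomial_of ` graver_basis A) \<and>
     (\<forall>r (G :: ('n, 'k) mpoly set). monomial_order r \<longrightarrow> reduced_groebner_basis r (toric_ideal A) G \<longrightarrow>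
        eq_up_to_sign G (binomial_of ` graver_basis A)) \<and>
     (\<forall>M. minimal_markov_basis K A M \<longrightarrow> eq_up_to_sign M (graver_basis A))"


section \<open>The S-Lawrence property\<close>

definition fiber :: "int^'n^'m \<Rightarrow> nat^'n \<Rightarrow> (nat^'n) set" where
  "fiber C b = {t. (\<chi> i. int (b $ i) - int (t $ i)) \<in> int_kernel C}"

definition S_Lawrence :: "'n set \<Rightarrow> int^'n^'m \<Rightarrow> bool" where
  "S_Lawrence S C \<longleftrightarrow>
     (\<forall>u\<in>graver_basis C.
        \<not> (\<exists>w\<in>fiber C (pos_part u). w \<noteq> pos_part u \<and> w \<noteq> neg_part u \<and>
              (\<forall>i\<in>S. w $ i \<in> {0..max (pos_part u $ i) (neg_part u $ i)})))"

end

theory Submission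
  imports Defs
begin

text \<open>
  All three conditions are equivalent to an indecomposability property of Graver basis elements.

  An element \<open>u\<close> of the Graver basis of \<open>A\<close> is indispensable exactly if it has no proper
  semiconformal decomposition \<open>u = v + w\<close>. Such a decomposition means that
  \<open>x\<^bsup>u\<^sup>+\<^esup> - x\<^bsup>u\<^sup>-\<^esup>\<close> is a combination, with monomial coefficients, of the binomials of \<open>v\<close> and \<open>w\<close>, so a
  Markov basis can avoid \<open>u\<close> (\<open>markov_basis_avoiding_decomposable\<close>). Conversely, if the binomial of \<open>u\<close> is
  in the ideal generated by a Markov basis, then some element of the basis has, up to sign, a positive
  part below \<open>u\<^sup>+\<close>, which yields a semiconformal decomposition unless this element is \<open>u\<close> itself
  (\<open>indecomposable_in_markov_basis\<close>). Since the Graver basis is finite and generates the toric ideal, strong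
  robustness says that no Graver basis element of \<open>A\<close> has a proper semiconformal decomposition
  (\<open>strongly_robust_iff_indecomposable\<close>). A special case arises if \<open>u\<close> or \<open>- u\<close> is nonnegative: then
  \<open>u = (- u) + 2u\<close> or \<open>u = 2u + (- u)\<close> is semiconformal but contains \<open>u\<close> up to sign, and a Markov
  basis avoids \<open>u\<close> by means of \<open>2u\<close> and \<open>3u\<close> instead (\<open>markov_basis_avoiding_nonneg\<close>).

  For every monomial order the Graver binomials, each with the sign that makes its positive monomial
  the leading one, form a Groebner basis. Without semiconformal decompositions this Groebner basis is
  reduced, hence the only reduced one. So in a strongly robust toric ideal all the bases coincide
  (\<open>bases_coincide_iff_strongly_robust\<close>).

  The map \<open>u \<mapsto> \<Sum>\<^sub>k u\<^sub>k c\<^sub>k\<close> identifies the kernel of the bouquet matrix with the kernel of \<open>A\<close>. It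
  preserves and reflects conformality, so it identifies the Graver bases. Semiconformality of the image of
  \<open>u = v + w\<close> asks more than semiconformality of \<open>u = v + w\<close>: a negative entry of \<open>c\<^sub>k\<close> reverses the
  condition, so on a bouquet with entries of both signs, that is, on a mixed bouquet, it becomes
  conformality (\<open>semiconformal_bouquet_lift_iff\<close>). This turns strong robustness into condition (a).

  Finally, \<open>t = u\<^sup>+ - v\<close> turns semiconformal decompositions of \<open>u\<close> into elements of the fiber of \<open>u\<^sup>+\<close>,
  and conformality on \<open>S\<close> into the condition defining \<open>P\<^sub>S(u)\<close>, which gives the equivalence of (a)
  and (c) for each \<open>u\<close> separately (\<open>semiconformally_decomposable_iff_fiber\<close>).
\<close>


(* As a simplification rule this law of modules would rotate products against mult.assoc. *)
declare ideal.scale_scale [simp del]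


section \<open>Decompositions of kernel vectors, coordinate by coordinate\<close>

lemma zero_in_kernel: "0 \<in> int_kernel A"
  by (simp add: int_kernel_def)

lemma add_in_kernel: "v \<in> int_kernel A \<Longrightarrow> w \<in> int_kernel A \<Longrightarrow> v + w \<in> int_kernel A"
  by (simp add: int_kernel_def matrix_vector_right_distrib)

lemma diff_in_kernel: "v \<in> int_kernel A \<Longrightarrow> w \<in> int_kernel A \<Longrightarrow> v - w \<in> int_kernel A"
  for v w :: "int^'n"
  by (simp add: int_kernel_def vec_eq_iff matrix_vector_mult_def right_diff_distrib sum_subtractf)

lemma uminus_in_kernel: "v \<in> int_kernel A \<Longrightarrow> - v \<in> int_kernel A" for v :: "int^'n"
  using diff_in_kernel[OF zero_in_kernel] by fastforce

lemma pos_part_uminus: "pos_part (- u) = neg_part u"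
  by (simp add: pos_part_def neg_part_def)

lemma neg_part_uminus: "neg_part (- u) = pos_part u"
  by (simp add: pos_part_def neg_part_def)

lemma int_pos_part_minus_neg_part: "int (pos_part u $ i) - int (neg_part u $ i) = u $ i"
  by (simp add: pos_part_def neg_part_def)

lemma pos_part_eq_neg_part_iff: "pos_part u = neg_part u \<longleftrightarrow> u = 0"
proof
  assume "pos_part u = neg_part u"
  then have "u $ i = 0" for i
    using int_pos_part_minus_neg_part[of u i] by simp
  then show "u = 0"
    by (simp add: vec_eq_iff)
qed (simp add: pos_part_def neg_part_def)

lemma conformal_on_iff_same_sign:
  assumes "u = v + w"
  shows "conformal_on S u v w \<longleftrightarrow>
    (\<forall>i\<in>S. (0 \<le> v $ i \<and> 0 \<le> w $ i) \<or> (v $ i \<le> 0 \<and> w $ i \<le> 0))"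
  by (auto simp: conformal_on_def pos_part_def neg_part_def assms)

lemma conformal_iff_conformal_on_UNIV: "conformal u v w \<longleftrightarrow> conformal_on UNIV u v w"
  by (auto simp: conformal_def conformal_on_def vec_eq_iff)

lemma conformal_iff_parts_le:
  assumes "u = v + w"
  shows "conformal u v w \<longleftrightarrow> pos_part v \<le> pos_part u \<and> neg_part v \<le> neg_part u"
proof -
  have "(0 \<le> v $ i \<and> 0 \<le> w $ i) \<or> (v $ i \<le> 0 \<and> w $ i \<le> 0) \<longleftrightarrow>
      pos_part v $ i \<le> pos_part u $ i \<and> neg_part v $ i \<le> neg_part u $ i" for i
    by (auto simp: pos_part_def neg_part_def assms)
  then show ?thesis
    by (simp add: conformal_iff_conformal_on_UNIV conformal_on_iff_same_sign[OF assms]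
        less_eq_vec_def all_conj_distrib)
qed

lemma semiconformal_iff_parts_le:
  assumes "u = v + w"
  shows "semiconformal v w \<longleftrightarrow> pos_part v \<le> pos_part u \<and> neg_part w \<le> neg_part u"
proof -
  have "(v $ i > 0 \<longrightarrow> w $ i \<ge> 0) \<and> (w $ i < 0 \<longrightarrow> v $ i \<le> 0) \<longleftrightarrow>
      pos_part v $ i \<le> pos_part u $ i \<and> neg_part w $ i \<le> neg_part u $ i" for i
    by (auto simp: pos_part_def neg_part_def assms)
  then show ?thesis
    by (simp add: semiconformal_def less_eq_vec_def all_conj_distrib)
qed

lemma conformal_imp_semiconformal:
  assumes "u = v + w" "conformal u v w"
  shows "semiconformal v w"
  using assms(2) unfolding conformal_iff_conformal_on_UNIV conformal_on_iff_same_sign[OF assms(1)]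
    semiconformal_def by force

lemma conformal_uminus: "conformal (- u) (- v) (- w) \<longleftrightarrow> conformal u v w"
  by (auto simp: conformal_def pos_part_uminus neg_part_uminus)

lemma uminus_in_graver_basis:
  fixes u :: "int^'n"
  assumes "u \<in> graver_basis A"
  shows "- u \<in> graver_basis A"
proof -
  have False if "proper_decomposition A (- u) v w" "conformal (- u) v w" for v w
  proof -
    have "- u = v + w" "v \<in> int_kernel A" "w \<in> int_kernel A" "v \<noteq> 0" "w \<noteq> 0"
      using that(1) by (simp_all add: proper_decomposition_def decomposition_def)
    moreover from this have "u = - v + - w"
      by (metis add.inverse_inverse minus_add_distrib)
    ultimately have "proper_decomposition A u (- v) (- w)"
      using assms uminus_in_kernel
      unfolding proper_decomposition_def decomposition_def graver_basis_def by auto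
    moreover have "conformal u (- v) (- w)"
      using that(2) conformal_uminus[of "- u" v w] by simp
    ultimately show False
      using assms by (auto simp: graver_basis_def)
  qed
  then show ?thesis
    using assms by (auto simp: graver_basis_def uminus_in_kernel)
qed

text \<open>The set \<open>S\<close> is a parameter because the property is needed for the matrix \<open>A\<close> with \<open>S = {}\<close>,
  where it characterizes the dispensable Graver basis elements, and for the bouquet matrix with the set of mixed
  bouquets.\<close>

definition semiconformally_decomposable :: "'n set \<Rightarrow> int^'n^'m \<Rightarrow> int^'n \<Rightarrow> bool" where
  "semiconformally_decomposable S A u \<longleftrightarrow>
     (\<exists>v w. proper_decomposition A u v w \<and> semiconformal v w \<and> conformal_on S u v w)"

lemma semiconformally_decomposable_empty_iff:
  "semiconformally_decomposable {} A u \<longleftrightarrow> (\<exists>v w. proper_decomposition A u v w \<and> semiconformal v w)"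
  by (simp add: semiconformally_decomposable_def conformal_on_def)

text \<open>For a kernel vector \<open>v\<close>, the divisibility of \<open>x\<^bsup>u\<^sup>+\<^esup>\<close> by \<open>x\<^bsup>v\<^sup>+\<^esup>\<close> already makes \<open>u = v + (u - v)\<close>
  semiconformal. This is how decompositions arise from divisibility of monomials, both in Markov
  bases and in Groebner bases.\<close>

lemma semiconformally_decomposableI:
  fixes u v :: "int^'n"
  assumes "u \<in> int_kernel A" "v \<in> int_kernel A" "v \<noteq> 0" "v \<noteq> u" "pos_part v \<le> pos_part u"
  shows "semiconformally_decomposable {} A u"
proof -
  have "neg_part (u - v) $ i \<le> neg_part u $ i" for i
    using assms(5) unfolding less_eq_vec_def
    by (elim allE[of _ i]) (auto simp: pos_part_def neg_part_def)
  then have "semiconformal v (u - v)"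
    using assms(5) by (simp add: semiconformal_iff_parts_le[of u] less_eq_vec_def)
  moreover have "proper_decomposition A u v (u - v)"
    using assms(1-4) by (simp add: proper_decomposition_def decomposition_def diff_in_kernel)
  ultimately show ?thesis
    by (auto simp: semiconformally_decomposable_empty_iff)
qed


section \<open>The Graver basis\<close>

text \<open>Splitting a kernel vector conformally decreases the sum of the absolute values of the
  coordinates, so every nonzero kernel vector is an iterated conformal sum of Graver basis elements.\<close>

lemma kernel_conformal_induct [consumes 2, case_names graver conformal]:
  fixes A :: "int^'n::finite^'m"
  assumes "z \<in> int_kernel A" "z \<noteq> 0"
    and graver: "\<And>u. u \<in> graver_basis A \<Longrightarrow> P u"
    and conformal: "\<And>v w. v \<in> int_kernel A \<Longrightarrow> w \<in> int_kernel A \<Longrightarrow> v \<noteq> 0 \<Longrightarrow> w \<noteq> 0 \<Longrightarrow>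
      conformal (v + w) v w \<Longrightarrow> P v \<Longrightarrow> P w \<Longrightarrow> P (v + w)"
  shows "P z"
  using assms(1,2)
proof (induction "\<Sum>i\<in>UNIV. nat \<bar>z $ i\<bar>" arbitrary: z rule: less_induct)
  case less
  show ?case
  proof (cases "z \<in> graver_basis A")
    case False
    then obtain v w where vw: "proper_decomposition A z v w" "conformal z v w"
      using less.prems by (auto simp: graver_basis_def)
    then have *: "v \<in> int_kernel A" "w \<in> int_kernel A" "v \<noteq> 0" "w \<noteq> 0" "z = v + w"
      by (auto simp: proper_decomposition_def decomposition_def)
    define N where "N = (\<lambda>x :: int^'n. \<Sum>i\<in>UNIV. nat \<bar>x $ i\<bar>)"
    have "nat \<bar>z $ i\<bar> = nat \<bar>v $ i\<bar> + nat \<bar>w $ i\<bar>" for i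
    proof -
      have "0 \<le> v $ i \<and> 0 \<le> w $ i \<or> v $ i \<le> 0 \<and> w $ i \<le> 0"
        using vw(2) by (auto simp: conformal_iff_conformal_on_UNIV conformal_on_iff_same_sign[OF *(5)])
      then show ?thesis
        by (auto simp: *(5))
    qed
    then have "N z = N v + N w"
      by (simp add: N_def sum.distrib)
    moreover have "N x > 0" if nonzero: "x \<noteq> 0" for x
    proof -
      obtain i where "x $ i \<noteq> 0"
        using nonzero by (auto simp: vec_eq_iff)
      then show ?thesis
        unfolding N_def by (intro sum_pos2[of _ i]) auto
    qed
    ultimately have "N v < N z" "N w < N z"
      using * by simp_all
    then show ?thesis
      using less.hyps[of v] less.hyps[of w] conformal[of v w] * vw(2) by (simp add: N_def)
  qed (rule graver)
qed

text \<open>A weakly decreasing sequence of natural numbers is eventually constant, so the monotone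
  subsequence that every sequence has can be taken increasing.\<close>

lemma nat_seq_incseq_subseq:
  fixes f :: "nat \<Rightarrow> nat"
  shows "\<exists>r. strict_mono r \<and> incseq (\<lambda>k. f (r k))"
proof -
  obtain s where s: "strict_mono s" "monoseq (\<lambda>k. f (s k))"
    using seq_monosub by blast
  consider "incseq (\<lambda>k. f (s k))" | "decseq (\<lambda>k. f (s k))"
    using s(2) by (auto simp: monoseq_iff)
  then show ?thesis
  proof cases
    case 2
    define N where "N = arg_min (\<lambda>k. f (s k)) (\<lambda>_. True)"
    have N: "f (s N) \<le> f (s k)" for k
      unfolding N_def by (rule arg_min_nat_le) simp
    have "f (s (N + k)) = f (s N)" for k
      using decseqD[OF 2, of N "N + k"] N[of "N + k"] by simp
    then have "incseq (\<lambda>k. f (s (N + k)))"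
      by (simp add: incseq_def)
    moreover have "strict_mono (\<lambda>k. s (N + k))"
      using s(1) by (simp add: strict_mono_def)
    ultimately show ?thesis
      by blast
  qed (use s in blast)
qed

lemma finite_family_incseq_subseq:
  fixes f :: "'i \<Rightarrow> nat \<Rightarrow> nat"
  assumes "finite I"
  shows "\<exists>r. strict_mono r \<and> (\<forall>i\<in>I. incseq (\<lambda>k. f i (r k)))"
  using assms
proof (induction I)
  case empty
  show ?case
    by (rule exI[of _ id]) (simp add: strict_mono_def)
next
  case (insert j I)
  then obtain r where r: "strict_mono r" "\<forall>i\<in>I. incseq (\<lambda>k. f i (r k))"
    by blast
  obtain s where s: "strict_mono s" "incseq (\<lambda>k. f j (r (s k)))"
    using nat_seq_incseq_subseq[of "\<lambda>k. f j (r k)"] by blast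
  have "incseq (\<lambda>k. f i (r (s k)))" if "i \<in> I" for i
  proof -
    have "incseq (\<lambda>k. f i (r k))"
      using r(2) that by blast
    then show ?thesis
      unfolding incseq_def using strict_mono_less_eq[OF s(1)] by blast
  qed
  with s r(1) show ?case
    by (intro exI[of _ "\<lambda>k. r (s k)"]) (auto simp: strict_mono_def)
qed

text \<open>Dickson's lemma: an infinite set would contain a sequence of distinct elements on which, after
  passing to a subsequence, all coordinates weakly increase.\<close>

lemma finite_if_antichain:
  fixes f :: "'i \<Rightarrow> 'a \<Rightarrow> nat"
  assumes "finite I"
    and antichain: "\<And>x y. x \<in> X \<Longrightarrow> y \<in> X \<Longrightarrow> \<forall>i\<in>I. f i x \<le> f i y \<Longrightarrow> x = y"
  shows "finite X"
proof (rule ccontr)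
  assume "infinite X"
  then obtain g :: "nat \<Rightarrow> 'a" where g: "inj g" "range g \<subseteq> X"
    by (auto simp: infinite_iff_countable_subset)
  obtain r where r: "strict_mono r" "\<forall>i\<in>I. incseq (\<lambda>k. f i (g (r k)))"
    using finite_family_incseq_subseq[OF assms(1), of "\<lambda>i k. f i (g k)"] by blast
  have "g (r 0) = g (r 1)"
    using g(2) r(2) by (intro antichain) (auto simp: incseq_def)
  then have "r 0 = r 1"
    using g(1) by (simp add: inj_eq)
  then show False
    using r(1) strict_mono_eq zero_neq_one by blast
qed

lemma finite_graver_basis:
  fixes A :: "int^'n::finite^'m"
  shows "finite (graver_basis A)"
proof (rule finite_if_antichain)
  define f where "f = (\<lambda>(p, i) u. if p then pos_part u $ i else neg_part (u :: int^'n) $ i)"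
  show "finite (UNIV :: (bool \<times> 'n) set)"
    by simp
  fix v u
  assume v: "v \<in> graver_basis A" and u: "u \<in> graver_basis A"
    and le: "\<forall>i\<in>UNIV. f i v \<le> f i u"
  have "f (True, i) v \<le> f (True, i) u" "f (False, i) v \<le> f (False, i) u" for i
    using le by blast+
  then have "pos_part v \<le> pos_part u" "neg_part v \<le> neg_part u"
    by (simp_all add: f_def less_eq_vec_def)
  then have "conformal u v (u - v)"
    by (simp add: conformal_iff_parts_le)
  moreover have "decomposition A u v (u - v)" "v \<noteq> 0"
    using u v by (simp_all add: decomposition_def graver_basis_def diff_in_kernel)
  ultimately have "u - v = 0"
    using u unfolding graver_basis_def proper_decomposition_def by blast
  then show "v = u"
    by simp
qed


section \<open>Ideals generated by binomials\<close>

lemma monomial_mult: "monomial a * monomial b = (monomial (a + b) :: ('n::finite, 'k::field) mpoly)"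
  by (simp add: monomial_def mult_single)

lemma keys_monomial: "Poly_Mapping.keys (monomial a :: ('n::finite, 'k::field) mpoly) = {a}"
  by (simp add: monomial_def)

lemma binomial_of_zero [simp]: "binomial_of 0 = 0"
  by (simp add: binomial_of_def pos_part_def neg_part_def)

lemma binomial_of_uminus: "binomial_of (- u) = - binomial_of u"
  by (simp add: binomial_of_def pos_part_uminus neg_part_uminus)

lemma keys_binomial_of:
  assumes "u \<noteq> 0"
  shows "Poly_Mapping.keys (binomial_of u :: ('n::finite, 'k::field) mpoly) = {pos_part u, neg_part u}"
  using assms
  by (auto simp: binomial_of_def monomial_def in_keys_iff lookup_minus lookup_single when_def
      simp flip: pos_part_eq_neg_part_iff split: if_splits)

text \<open>Every polynomial is a sum of terms, so the ideal generated by \<open>G\<close> is already the additive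
  closure of the products of a term with an element of \<open>G\<close>.\<close>

lemma ideal_span_additive_induct [consumes 1, case_names zero add mult_term]:
  fixes f :: "('n::finite, 'k::field) mpoly"
  assumes "f \<in> ideal.span G"
    and zero: "P 0"
    and add: "\<And>f g. P f \<Longrightarrow> P g \<Longrightarrow> P (f + g)"
    and mult_term: "\<And>t c g. g \<in> G \<Longrightarrow> P (Poly_Mapping.single t c * g)"
  shows "P f"
  using assms(1)
proof (induction rule: ideal.span_induct_alt)
  case (step p g f)
  have "P (p * g)"
  proof (induction p rule: update_induct)
    case (update p t c)
    have "Poly_Mapping.update t c p = Poly_Mapping.single t c + p"
      using update.hyps(1)
      by (auto intro!: poly_mapping_eqI simp: lookup_update lookup_add lookup_single in_keys_iff)
    then show ?case
      using mult_term[OF step.hyps(1), of t c] update.IH by (simp add: distrib_right add)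
  qed (simp add: zero)
  then show ?case
    using step.IH by (rule add)
qed (rule zero)

text \<open>The exponents that lie above some exponent of an element of \<open>G\<close> form an up-set, and the
  polynomials supported on an up-set form an ideal.\<close>

lemma ideal_span_keys_above:
  fixes f :: "('n::finite, 'k::field) mpoly"
  assumes "f \<in> ideal.span G" "a \<in> Poly_Mapping.keys f"
  shows "\<exists>g\<in>G. \<exists>b\<in>Poly_Mapping.keys g. b \<le> a"
proof -
  have "\<forall>a\<in>Poly_Mapping.keys f. \<exists>g\<in>G. \<exists>b\<in>Poly_Mapping.keys g. b \<le> a"
    using assms(1)
  proof (induction rule: ideal_span_additive_induct)
    case (add f g)
    then show ?case
      using keys_add[of f g] by blast
  next
    case (mult_term t c g)
    show ?case
    proof
      fix a assume "a \<in> Poly_Mapping.keys (Poly_Mapping.single t c * g)"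
      then obtain b where "b \<in> Poly_Mapping.keys g" "a = t + b"
        using keys_mult[of "Poly_Mapping.single t c" g] by (auto split: if_splits)
      then have "b \<in> Poly_Mapping.keys g" "b \<le> a"
        by (auto simp: less_eq_vec_def)
      with mult_term show "\<exists>g\<in>G. \<exists>b\<in>Poly_Mapping.keys g. b \<le> a"
        by blast
    qed
  qed simp
  with assms(2) show ?thesis
    by blast
qed

lemma monomial_in_ideal_span_monomials:
  fixes a :: "nat^'n::finite"
  assumes "(monomial a :: ('n::finite, 'k::field) mpoly) \<in> ideal.span (monomial ` E)"
  shows "\<exists>e\<in>E. e \<le> a"
  using ideal_span_keys_above[OF assms, of a] by (auto simp: keys_monomial)

lemma fiber_iff: "t \<in> fiber A a \<longleftrightarrow> (\<chi> i. int (a $ i) - int (t $ i)) \<in> int_kernel A"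
  by (simp add: fiber_def)

lemma fiber_shift_iff:
  fixes u :: "int^'n"
  assumes "u \<in> int_kernel A"
  shows "s + pos_part u \<in> fiber A a \<longleftrightarrow> s + neg_part u \<in> fiber A a"
proof -
  define p where "p = (\<chi> i. int (a $ i) - int ((s + pos_part u) $ i))"
  have "(\<chi> i. int (a $ i) - int ((s + neg_part u) $ i)) = p + u"
    using int_pos_part_minus_neg_part[of u] by (simp add: p_def vec_eq_iff algebra_simps)
  moreover have "p + u \<in> int_kernel A \<longleftrightarrow> p \<in> int_kernel A"
    using add_in_kernel[OF _ assms] diff_in_kernel[OF _ assms] by (metis add_diff_cancel_right')
  ultimately show ?thesis
    by (simp add: fiber_iff p_def)
qed

text \<open>The sum of the coefficients over a fiber is additive and vanishes on each product of a
  term with a binomial, so it vanishes on the toric ideal; hence no fiber meets the support of an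
  element of the toric ideal in a single exponent.\<close>

lemma toric_ideal_another_key_in_fiber:
  fixes f :: "('n::finite, 'k::field) mpoly"
  assumes "f \<in> toric_ideal A" "a \<in> Poly_Mapping.keys f"
  shows "\<exists>b\<in>Poly_Mapping.keys f. b \<noteq> a \<and> b \<in> fiber A a"
proof (rule ccontr)
  assume alone: "\<not> ?thesis"
  define coeff where "coeff = (\<lambda>t (x :: 'k). if t \<in> fiber A a then x else 0)"
  define L where "L = (\<lambda>f :: ('n, 'k) mpoly. \<Sum>t\<in>Poly_Mapping.keys f. coeff t (Poly_Mapping.lookup f t))"
  have L_add: "L (f + g) = L f + L g" for f g
    unfolding L_def by (rule setsum_keys_plus_distrib) (simp_all add: coeff_def)
  have L_single: "L (Poly_Mapping.single t x) = coeff t x" for t x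
    by (simp add: L_def coeff_def)
  have "L f = 0"
    using assms(1) unfolding toric_ideal_def
  proof (induction rule: ideal_span_additive_induct)
    case (mult_term t c g)
    then obtain u where u: "u \<in> int_kernel A" "g = binomial_of u"
      by blast
    have "Poly_Mapping.single t c * g + Poly_Mapping.single (t + neg_part u) c
        = Poly_Mapping.single (t + pos_part u) c"
      by (simp add: u(2) binomial_of_def monomial_def mult_single right_diff_distrib)
    then have "L (Poly_Mapping.single t c * g) + coeff (t + neg_part u) c
        = coeff (t + pos_part u) c"
      by (metis L_add L_single)
    then show ?case
      using fiber_shift_iff[OF u(1), of t a] by (simp add: coeff_def)
  qed (simp_all add: L_add, simp add: L_def)
  moreover have "L f = coeff a (Poly_Mapping.lookup f a)"
  proof -
    have "coeff t (Poly_Mapping.lookup f t) = 0" if "t \<in> Poly_Mapping.keys f - {a}" for t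
      using alone that by (auto simp: coeff_def)
    then show ?thesis
      unfolding L_def by (subst sum.remove[OF _ assms(2)]) simp_all
  qed
  moreover have "a \<in> fiber A a"
    using zero_in_kernel by (simp add: fiber_iff vec_eq_iff[symmetric] zero_vec_def[symmetric])
  ultimately show False
    using assms(2) by (simp add: coeff_def in_keys_iff)
qed

text \<open>If \<open>u = v + w\<close> is semiconformal, one can walk from \<open>u\<^sup>+\<close> to \<open>u\<^sup>-\<close> by subtracting first \<open>v\<close>
  and then \<open>w\<close> without leaving the nonnegative orthant.\<close>

lemma binomial_of_semiconformal_sum:
  fixes u :: "int^'n::finite"
  assumes "u = v + w" "semiconformal v w"
  shows "(binomial_of u :: ('n::finite, 'k::field) mpoly) \<in> ideal.span {binomial_of v, binomial_of w}"
proof -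
  define s t where "s = pos_part u - pos_part v" and "t = neg_part u - neg_part w"
  have le: "pos_part v $ i \<le> pos_part u $ i" "neg_part w $ i \<le> neg_part u $ i" for i
    using assms(2) by (simp_all add: semiconformal_iff_parts_le[OF assms(1)] less_eq_vec_def)
  have s: "s + pos_part v = pos_part u" and t: "t + neg_part w = neg_part u"
    using le by (simp_all add: s_def t_def vec_eq_iff)
  have "s + neg_part v = t + pos_part w"
  proof -
    have "int ((s + neg_part v) $ i) = int ((t + pos_part w) $ i)" for i
      using le[of i] int_pos_part_minus_neg_part[of u i] int_pos_part_minus_neg_part[of v i]
        int_pos_part_minus_neg_part[of w i]
      by (simp add: s_def t_def assms(1) of_nat_diff)
    then show ?thesis
      by (simp only: vec_eq_iff of_nat_eq_iff) simp
  qed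
  then have "binomial_of u = monomial s * binomial_of v + (monomial t * binomial_of w :: ('n, 'k) mpoly)"
    by (simp add: binomial_of_def right_diff_distrib monomial_mult s t)
  then show ?thesis
    by (simp only:) (intro ideal.span_add ideal.span_scale ideal.span_base; simp)
qed

lemma toric_ideal_eq_span_graver_basis:
  fixes A :: "int^'n::finite^'m"
  shows "(toric_ideal A :: ('n::finite, 'k::field) mpoly set) = ideal.span (binomial_of ` graver_basis A)"
proof (rule antisym)
  show "ideal.span (binomial_of ` graver_basis A) \<subseteq> (toric_ideal A :: ('n, 'k) mpoly set)"
    unfolding toric_ideal_def by (intro ideal.span_mono image_mono) (auto simp: graver_basis_def)
  have "(binomial_of z :: ('n, 'k) mpoly) \<in> ideal.span (binomial_of ` graver_basis A)"
    if "z \<in> int_kernel A" "z \<noteq> 0" for z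
    using that
  proof (induction rule: kernel_conformal_induct)
    case (conformal v w)
    have "(binomial_of (v + w) :: ('n, 'k) mpoly) \<in> ideal.span {binomial_of v, binomial_of w}"
      using conformal by (intro binomial_of_semiconformal_sum conformal_imp_semiconformal) auto
    then show ?case
      using ideal.span_minimal[OF _ ideal.subspace_span] conformal.IH
      by (metis (no_types, lifting) empty_subsetI insert_subset subsetD)
  qed (simp add: ideal.span_base)
  then have "binomial_of ` int_kernel A \<subseteq> ideal.span (binomial_of ` graver_basis A :: ('n, 'k) mpoly set)"
    using ideal.span_zero by (metis (no_types, lifting) binomial_of_zero image_subsetI)
  then show "(toric_ideal A :: ('n, 'k) mpoly set) \<subseteq> ideal.span (binomial_of ` graver_basis A)"
    unfolding toric_ideal_def by (rule ideal.span_minimal) (rule ideal.subspace_span)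
qed


section \<open>Markov bases and strong robustness\<close>

lemma mem_sign_closure_iff:
  fixes u :: "int^'n"
  shows "u \<in> sign_closure M \<longleftrightarrow> u \<in> M \<or> - u \<in> M"
  by (auto simp: sign_closure_def) (metis add.inverse_inverse image_eqI)

lemma sign_closure_graver_basis: "sign_closure (graver_basis A) = graver_basis A"
  using uminus_in_graver_basis by (auto simp: sign_closure_def)

lemma markov_basisI:
  fixes A :: "int^'n::finite^'m"
  assumes "finite M" "M \<subseteq> int_kernel A"
    and "\<And>u. u \<in> graver_basis A \<Longrightarrow>
      (binomial_of u :: ('n, 'k::field) mpoly) \<in> ideal.span (binomial_of ` M)"
  shows "markov_basis TYPE('k) A M"
proof -
  have "(toric_ideal A :: ('n, 'k) mpoly set) \<subseteq> ideal.span (binomial_of ` M)"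
    unfolding toric_ideal_eq_span_graver_basis
    using assms(3) by (intro ideal.span_minimal) auto
  moreover have "ideal.span (binomial_of ` M) \<subseteq> (toric_ideal A :: ('n, 'k) mpoly set)"
    unfolding toric_ideal_def using assms(2) by (intro ideal.span_mono image_mono)
  ultimately show ?thesis
    using assms(1,2) by (auto simp: markov_basis_def)
qed

lemma graver_basis_is_markov_basis:
  fixes A :: "int^'n::finite^'m"
  shows "markov_basis TYPE('k::field) A (graver_basis A)"
  by (rule markov_basisI) (auto simp: finite_graver_basis ideal.span_base, simp add: graver_basis_def)

lemma minimal_markov_basis_subset:
  assumes "markov_basis K A M"
  shows "\<exists>N\<subseteq>M. minimal_markov_basis K A N"
proof -
  have "finite M"
    using assms by (simp add: markov_basis_def)
  then show ?thesis
    using assms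
  proof (induction M rule: finite_psubset_induct)
    case (psubset M)
    then show ?case
      unfolding minimal_markov_basis_def by (meson order.trans psubset_imp_subset subset_refl)
  qed
qed

text \<open>A monomial of \<open>x\<^bsup>u\<^sup>+\<^esup> - x\<^bsup>u\<^sup>-\<^esup>\<close> must be divisible by a monomial of some element \<open>m\<close> of the
  Markov basis; up to the sign of \<open>m\<close> this means that \<open>u = m + (u - m)\<close> is semiconformal.\<close>

lemma indecomposable_in_markov_basis:
  fixes A :: "int^'n::finite^'m"
  assumes "markov_basis TYPE('k::field) A M"
    and u: "u \<in> int_kernel A" "u \<noteq> 0" "\<not> semiconformally_decomposable {} A u"
  shows "u \<in> sign_closure M"
proof -
  have M: "M \<subseteq> int_kernel A" "(binomial_of u :: ('n, 'k) mpoly) \<in> ideal.span (binomial_of ` M)"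
    using assms(1) u(1) by (auto simp: markov_basis_def toric_ideal_def ideal.span_base)
  have "pos_part u \<in> Poly_Mapping.keys (binomial_of u :: ('n, 'k) mpoly)"
    by (simp add: keys_binomial_of[OF u(2)])
  then obtain m b where m: "m \<in> M" "b \<in> Poly_Mapping.keys (binomial_of m :: ('n, 'k) mpoly)"
      "b \<le> pos_part u"
    using ideal_span_keys_above[OF M(2)] by blast
  then have "m \<noteq> 0"
    by auto
  then have "pos_part m \<le> pos_part u \<or> pos_part (- m) \<le> pos_part u"
    using m(2,3) by (auto simp: keys_binomial_of pos_part_uminus)
  then obtain v where v: "v = m \<or> v = - m" "pos_part v \<le> pos_part u"
    by blast
  then have "v \<in> int_kernel A" "v \<noteq> 0"
    using m(1) M(1) \<open>m \<noteq> 0\<close> uminus_in_kernel by auto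
  then have "v = u"
    using semiconformally_decomposableI u v(2) by blast
  then show ?thesis
    using v(1) m(1) by (auto simp: mem_sign_closure_iff)
qed

lemma markov_basis_avoiding:
  fixes A :: "int^'n::finite^'m"
  assumes "finite N" "N \<subseteq> int_kernel A" "u \<notin> sign_closure N"
    and span: "(binomial_of u :: ('n, 'k::field) mpoly) \<in> ideal.span (binomial_of ` N)"
  shows "\<exists>M. markov_basis TYPE('k) A M \<and> u \<notin> sign_closure M"
proof (intro exI conjI)
  let ?M = "graver_basis A - {u, - u} \<union> N"
  show "u \<notin> sign_closure ?M"
    using assms(3) by (simp add: mem_sign_closure_iff)
  have span_M: "(binomial_of u :: ('n, 'k) mpoly) \<in> ideal.span (binomial_of ` ?M)"
    using span ideal.span_mono[OF image_mono[of N ?M binomial_of]] by blast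
  have "(binomial_of z :: ('n, 'k) mpoly) \<in> ideal.span (binomial_of ` ?M)"
    if z: "z \<in> graver_basis A" for z
  proof -
    consider "z = u" | "z = - u" | "z \<in> ?M"
      using z by blast
    then show ?thesis
    proof cases
      case 2
      then show ?thesis
        using ideal.span_neg[OF span_M] by (simp add: binomial_of_uminus)
    qed (use span_M in \<open>auto intro: ideal.span_base\<close>)
  qed
  then show "markov_basis TYPE('k) A ?M"
    using assms(1,2) by (intro markov_basisI) (auto simp: finite_graver_basis, simp add: graver_basis_def)
qed

text \<open>A nonnegative kernel vector is never indispensable: its binomial \<open>y - 1\<close> lies in the ideal of
  \<open>y\<^sup>2 - 1\<close> and \<open>y\<^sup>3 - 1\<close>.\<close>

lemma markov_basis_avoiding_nonneg:
  fixes A :: "int^'n::finite^'m"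
  assumes u: "u \<in> int_kernel A" "u \<noteq> 0" "neg_part u = 0"
  shows "\<exists>M. markov_basis TYPE('k::field) A M \<and> u \<notin> sign_closure M"
proof (rule markov_basis_avoiding)
  let ?N = "{u + u, u + u + u}"
  show "finite ?N" "?N \<subseteq> int_kernel A"
    using add_in_kernel[OF u(1) u(1)] add_in_kernel[OF add_in_kernel[OF u(1) u(1)] u(1)] by simp_all
  obtain i where i: "u $ i \<noteq> 0"
    using u(2) by (auto simp: vec_eq_iff)
  have "x \<noteq> u" "x \<noteq> - u" if "x \<in> ?N" for x
  proof -
    have "x $ i \<noteq> u $ i" "x $ i \<noteq> (- u) $ i"
      using that i by auto
    then show "x \<noteq> u" "x \<noteq> - u"
      by auto
  qed
  then show "u \<notin> sign_closure ?N"
    unfolding mem_sign_closure_iff by blast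
  define y :: "('n, 'k) mpoly" where "y = monomial (pos_part u)"
  have nonneg: "0 \<le> u $ i" for i
  proof -
    have "neg_part u $ i = 0"
      using u(3) by simp
    then show ?thesis
      by (simp add: neg_part_def)
  qed
  have one: "monomial 0 = (1 :: ('n, 'k) mpoly)"
    by (simp add: monomial_def)
  have "nat (u $ i + u $ i) = nat (u $ i) + nat (u $ i)"
    "nat (u $ i + u $ i + u $ i) = nat (u $ i) + nat (u $ i) + nat (u $ i)" for i
    using nonneg[of i] by linarith+
  then have "pos_part (u + u) = pos_part u + pos_part u" "neg_part (u + u) = 0"
    "pos_part (u + u + u) = pos_part u + pos_part u + pos_part u" "neg_part (u + u + u) = 0"
    using nonneg by (simp_all add: pos_part_def neg_part_def vec_eq_iff)
  then have "binomial_of u = y - 1" "binomial_of (u + u) = y * y - 1"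
    "binomial_of (u + u + u) = y * y * y - 1"
    by (simp_all add: binomial_of_def y_def monomial_mult u(3) one)
  moreover have "y - 1 = (y * y * y - 1) - y * (y * y - 1)"
    by (simp add: right_diff_distrib)
  ultimately have "binomial_of u = binomial_of (u + u + u) - y * binomial_of (u + u)"
    by presburger
  then show "(binomial_of u :: ('n, 'k) mpoly) \<in> ideal.span (binomial_of ` ?N)"
    by (simp only:) (intro ideal.span_diff ideal.span_scale ideal.span_base; simp)
qed

text \<open>A proper semiconformal decomposition \<open>u = v + w\<close> allows the replacement of \<open>u\<close> by \<open>v\<close> and \<open>w\<close>,
  unless one of these is \<open>- u\<close>, and this happens only if \<open>u\<close> or \<open>- u\<close> is nonnegative.\<close>

lemma markov_basis_avoiding_decomposable:
  fixes A :: "int^'n::finite^'m"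
  assumes "semiconformally_decomposable {} A u" "u \<noteq> 0"
  shows "\<exists>M. markov_basis TYPE('k::field) A M \<and> u \<notin> sign_closure M"
proof -
  obtain v w where vw: "u \<in> int_kernel A" "v \<in> int_kernel A" "w \<in> int_kernel A" "u = v + w"
      "v \<noteq> 0" "w \<noteq> 0" "semiconformal v w"
    using assms(1) unfolding semiconformally_decomposable_empty_iff proper_decomposition_def
      decomposition_def by blast
  have disjoint: "pos_part u $ i = 0 \<or> neg_part u $ i = 0" for i
    by (auto simp: pos_part_def neg_part_def)
  have le: "pos_part v $ i \<le> pos_part u $ i" "neg_part w $ i \<le> neg_part u $ i" for i
    using vw(7) by (simp_all add: semiconformal_iff_parts_le[OF vw(4)] less_eq_vec_def)
  show ?thesis
  proof (cases "u \<in> sign_closure {v, w}")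
    case False
    then show ?thesis
      using vw(2,3) binomial_of_semiconformal_sum[OF vw(4,7)]
      by (intro markov_basis_avoiding[of "{v, w}"]) auto
  next
    case True
    moreover have "u \<noteq> v" "u \<noteq> w"
      using vw(4-6) by auto
    ultimately consider "v = - u" | "w = - u"
      by (auto simp: mem_sign_closure_iff)
    then show ?thesis
    proof cases
      case 1
      then have "neg_part u $ i = 0" for i
        using le(1)[of i] disjoint[of i] by (auto simp: pos_part_uminus)
      then show ?thesis
        using vw(1) assms(2) by (intro markov_basis_avoiding_nonneg) (simp_all add: vec_eq_iff)
    next
      case 2
      then have "pos_part u $ i = 0" for i
        using le(2)[of i] disjoint[of i] by (auto simp: neg_part_uminus)
      then have "\<exists>M. markov_basis TYPE('k) A M \<and> - u \<notin> sign_closure M"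
        using vw(1) assms(2) uminus_in_kernel[OF vw(1)]
        by (intro markov_basis_avoiding_nonneg) (simp_all add: neg_part_uminus vec_eq_iff)
      then show ?thesis
        by (auto simp: mem_sign_closure_iff)
    qed
  qed
qed

text \<open>By indecomposability the Markov basis contains the Graver basis up to sign, and the Graver elements in it
  already generate the toric ideal.\<close>

lemma minimal_markov_basis_eq_graver_basis:
  fixes A :: "int^'n::finite^'m"
  assumes "\<And>u. u \<in> graver_basis A \<Longrightarrow> \<not> semiconformally_decomposable {} A u"
    and M: "minimal_markov_basis TYPE('k::field) A M"
  shows "sign_closure M = graver_basis A"
proof
  have markov: "markov_basis TYPE('k) A M"
    using M by (simp add: minimal_markov_basis_def)
  then show graver: "graver_basis A \<subseteq> sign_closure M"
    using indecomposable_in_markov_basis assms(1) by (fastforce simp: graver_basis_def)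
  let ?N = "M \<inter> graver_basis A"
  have "(binomial_of u :: ('n, 'k) mpoly) \<in> ideal.span (binomial_of ` ?N)"
    if "u \<in> graver_basis A" for u
  proof -
    have "u \<in> ?N \<or> - u \<in> ?N"
      using that graver uminus_in_graver_basis mem_sign_closure_iff by blast
    then have "binomial_of u \<in> ideal.span (binomial_of ` ?N) \<or>
        - (binomial_of u :: ('n, 'k) mpoly) \<in> ideal.span (binomial_of ` ?N)"
      by (metis binomial_of_uminus ideal.span_base imageI)
    then show ?thesis
      using ideal.span_neg by fastforce
  qed
  moreover have "finite ?N" "?N \<subseteq> int_kernel A"
    using markov by (auto simp: markov_basis_def)
  ultimately have "markov_basis TYPE('k) A ?N"
    by (blast intro: markov_basisI)
  then have "\<not> ?N \<subset> M"
    using M by (auto simp only: minimal_markov_basis_def)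
  then have "?N = M"
    by blast
  then show "sign_closure M \<subseteq> graver_basis A"
    using sign_closure_graver_basis[of A] by (auto simp: sign_closure_def)
qed

text \<open>A Markov basis that avoids \<open>u\<close> contains a minimal one that avoids \<open>u\<close>, so \<open>u\<close> is then not
  indispensable; the indecomposable elements lie in all Markov bases.\<close>

lemma strongly_robust_iff_indecomposable:
  fixes A :: "int^'n::finite^'m"
  shows "strongly_robust TYPE('k::field) A \<longleftrightarrow>
    (\<forall>u\<in>graver_basis A. \<not> semiconformally_decomposable {} A u)"
proof
  assume robust: "strongly_robust TYPE('k) A"
  show "\<forall>u\<in>graver_basis A. \<not> semiconformally_decomposable {} A u"
  proof (intro ballI notI)
    fix u assume u: "u \<in> graver_basis A" "semiconformally_decomposable {} A u"
    then obtain M where M: "markov_basis TYPE('k) A M" "u \<notin> sign_closure M"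
      using markov_basis_avoiding_decomposable by (fastforce simp: graver_basis_def)
    obtain N where N: "N \<subseteq> M" "minimal_markov_basis TYPE('k) A N"
      using minimal_markov_basis_subset[OF M(1)] by blast
    have "u \<in> sign_closure (indispensable TYPE('k) A)"
      using u(1) robust sign_closure_graver_basis[of A]
      by (simp add: strongly_robust_def eq_up_to_sign_def)
    then have "u \<in> sign_closure N"
      using N(2) by (auto simp: mem_sign_closure_iff indispensable_def)
    then show False
      using M(2) N(1) by (auto simp: mem_sign_closure_iff)
  qed
next
  assume "\<forall>u\<in>graver_basis A. \<not> semiconformally_decomposable {} A u"
  then have "sign_closure M = graver_basis A" if "minimal_markov_basis TYPE('k) A M" for M
    using minimal_markov_basis_eq_graver_basis that by blast
  moreover obtain M where "minimal_markov_basis TYPE('k) A M"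
    using minimal_markov_basis_subset[OF graver_basis_is_markov_basis] by blast
  ultimately have "indispensable TYPE('k) A = graver_basis A"
    unfolding indispensable_def by blast
  then show "strongly_robust TYPE('k) A"
    by (simp add: strongly_robust_def eq_up_to_sign_def)
qed


section \<open>Groebner bases\<close>

context
  fixes r :: "(nat^'n::finite) rel"
  assumes order: "monomial_order r"
begin

lemma monomial_order_refl: "(a, a) \<in> r"
  using order by (simp add: monomial_order_def order_on_defs refl_on_def)

lemma monomial_order_linear: "(a, b) \<in> r \<or> (b, a) \<in> r"
  using order monomial_order_refl
  by (metis UNIV_I linear_order_on_def monomial_order_def total_on_def)

lemma monomial_order_trans: "(a, b) \<in> r \<Longrightarrow> (b, d) \<in> r \<Longrightarrow> (a, d) \<in> r"
  and monomial_order_antisym: "(a, b) \<in> r \<Longrightarrow> (b, a) \<in> r \<Longrightarrow> a = b"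
  using order
  by (auto simp: monomial_order_def order_on_defs dest: transD antisymD)

lemma monomial_order_add: "(a, b) \<in> r \<Longrightarrow> (a + d, b + d) \<in> r"
  using order by (simp add: monomial_order_def)

lemma monomial_order_add_cancel: "(a + d, b + d) \<in> r \<longleftrightarrow> (a, b) \<in> r"
  using monomial_order_add monomial_order_antisym monomial_order_linear
  by (metis add_right_cancel)

lemma monomial_order_extends_le:
  assumes "a \<le> b"
  shows "(a, b) \<in> r"
proof -
  have "(0 + a, (b - a) + a) \<in> r"
    using order unfolding monomial_order_def by blast
  moreover have "(b - a) + a = b"
    using assms by (simp add: vec_eq_iff less_eq_vec_def)
  ultimately show ?thesis
    by simp
qed

lemma lead_exp_eqI:
  fixes f :: "('n, 'k::field) mpoly"
  assumes "a \<in> Poly_Mapping.keys f" "\<And>b. b \<in> Poly_Mapping.keys f \<Longrightarrow> (b, a) \<in> r"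
  shows "lead_exp r f = a"
  unfolding lead_exp_def using assms monomial_order_antisym by (intro the_equality) blast+

lemma
  fixes f :: "('n, 'k::field) mpoly"
  assumes "f \<noteq> 0"
  shows lead_exp_in_keys: "lead_exp r f \<in> Poly_Mapping.keys f"
    and lead_exp_greatest: "b \<in> Poly_Mapping.keys f \<Longrightarrow> (b, lead_exp r f) \<in> r"
proof -
  have "\<exists>a\<in>X. \<forall>b\<in>X. (b, a) \<in> r" if "finite X" "X \<noteq> {}" for X
    using that
  proof (induction rule: finite_ne_induct)
    case (singleton x)
    then show ?case
      using monomial_order_refl by blast
  next
    case (insert x X)
    then obtain a where a: "a \<in> X" "\<forall>b\<in>X. (b, a) \<in> r"
      by blast
    show ?case
    proof (cases "(x, a) \<in> r")
      case True
      then show ?thesis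
        using a by blast
    next
      case False
      then have "(a, x) \<in> r"
        using monomial_order_linear by blast
      then show ?thesis
        using a monomial_order_trans monomial_order_refl by blast
    qed
  qed
  from this[of "Poly_Mapping.keys f"] obtain a where
    a: "a \<in> Poly_Mapping.keys f" "\<forall>b\<in>Poly_Mapping.keys f. (b, a) \<in> r"
    using assms by auto
  then have "lead_exp r f = a"
    by (intro lead_exp_eqI) blast+
  with a show "lead_exp r f \<in> Poly_Mapping.keys f"
    "b \<in> Poly_Mapping.keys f \<Longrightarrow> (b, lead_exp r f) \<in> r"
    by blast+
qed

lemma lead_exp_binomial_of:
  assumes "u \<noteq> 0" "(neg_part u, pos_part u) \<in> r"
  shows "lead_exp r (binomial_of u :: ('n, 'k::field) mpoly) = pos_part u"
  using assms monomial_order_refl by (intro lead_exp_eqI) (auto simp: keys_binomial_of)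

lemma groebner_basis_lead_exp_le:
  fixes f :: "('n, 'k::field) mpoly"
  assumes "groebner_basis r I G" "f \<in> I" "f \<noteq> 0"
  shows "\<exists>g\<in>G. lead_exp r g \<le> lead_exp r f"
proof -
  have "monomial (lead_exp r f) \<in> initial_ideal r I"
    unfolding initial_ideal_def using assms(2,3) by (intro ideal.span_base) blast
  then have "(monomial (lead_exp r f) :: ('n, 'k) mpoly) \<in>
      ideal.span (monomial ` (lead_exp r ` (G - {0})))"
    using assms(1) by (simp add: groebner_basis_def initial_ideal_def image_image)
  then show ?thesis
    using monomial_in_ideal_span_monomials by blast
qed

text \<open>The leading exponents of a reduced Groebner basis are the minimal exponents of the initial
  ideal, so each \<open>g \<in> G\<close> has a partner \<open>h \<in> G'\<close> with the same leading term. A monomial of \<open>g - h\<close>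
  occurs in \<open>g\<close> or in \<open>h\<close> without being a leading monomial, so by reducedness it is not in the
  initial ideal; hence \<open>g - h = 0\<close>.\<close>

lemma reduced_groebner_basis_subset:
  fixes I :: "('n, 'k::field) mpoly set"
  assumes I: "ideal.subspace I"
    and G: "reduced_groebner_basis r I G" and G': "reduced_groebner_basis r I G'"
  shows "G \<subseteq> G'"
proof
  fix g assume g: "g \<in> G"
  have gb: "groebner_basis r I G" "groebner_basis r I G'"
    using G G' by (simp_all add: reduced_groebner_basis_def)
  have sub: "G \<subseteq> I" "G' \<subseteq> I"
    using gb by (simp_all add: groebner_basis_def)
  have monic: "Poly_Mapping.lookup p (lead_exp r p) = 1" if "p \<in> G \<or> p \<in> G'" for p
    using that G G' by (auto simp: reduced_groebner_basis_def)
  have nonzero: "p \<noteq> 0" if "p \<in> G \<or> p \<in> G'" for p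
    using monic[OF that] by auto
  have reduced: "q = p" if "p \<in> F" "q \<in> F" "F = G \<or> F = G'" "a \<in> Poly_Mapping.keys p" "lead_exp r q \<le> a"
    for F p q a
    using that G G' unfolding reduced_groebner_basis_def by blast
  obtain h where h: "h \<in> G'" "lead_exp r h \<le> lead_exp r g"
    using groebner_basis_lead_exp_le[OF gb(2)] g sub nonzero by blast
  obtain g' where g': "g' \<in> G" "lead_exp r g' \<le> lead_exp r h"
    using groebner_basis_lead_exp_le[OF gb(1)] h(1) sub nonzero by blast
  have "g' = g"
    using reduced[OF g g'(1)] lead_exp_in_keys[OF nonzero] g g'(2) h(2) order.trans by blast
  then have lead: "lead_exp r h = lead_exp r g"
    using g'(2) h(2) by simp
  have "g - h = 0"
  proof (rule ccontr)
    assume diff: "g - h \<noteq> 0"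
    define a where "a = lead_exp r (g - h)"
    have "a \<in> Poly_Mapping.keys (g - h)"
      using lead_exp_in_keys[OF diff] by (simp add: a_def)
    then have a: "a \<noteq> lead_exp r g" "a \<in> Poly_Mapping.keys g \<or> a \<in> Poly_Mapping.keys h"
      using monic[of g] monic[of h] g h(1) lead by (auto simp: in_keys_iff lookup_minus)
    have "g - h \<in> I"
      using ideal.subspace_diff[OF I] g h(1) sub by blast
    then obtain p q where p: "p \<in> G" "lead_exp r p \<le> a" and q: "q \<in> G'" "lead_exp r q \<le> a"
      using groebner_basis_lead_exp_le[OF gb(1)] groebner_basis_lead_exp_le[OF gb(2)] diff
      unfolding a_def by metis
    from a(2) have "p = g \<or> q = h"
      using reduced[OF g p(1)] reduced[OF h(1) q(1)] p(2) q(2) by blast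
    then have "lead_exp r g \<le> a"
      using p(2) q(2) lead by auto
    moreover have "(a, lead_exp r g) \<in> r"
      using a(2) lead_exp_greatest[OF nonzero] g h(1) lead by metis
    ultimately show False
      using monomial_order_extends_le monomial_order_antisym a(1) by blast
  qed
  then show "g \<in> G'"
    using h(1) by simp
qed

lemma reduced_groebner_basis_unique:
  fixes I :: "('n, 'k::field) mpoly set"
  assumes "ideal.subspace I" "reduced_groebner_basis r I G" "reduced_groebner_basis r I G'"
  shows "G = G'"
  using reduced_groebner_basis_subset assms by (metis subset_antisym)

text \<open>If a sum of conformal vectors has its positive part in the lead, then so has one of the
  summands.\<close>

lemma graver_lead_below_kernel_lead:
  assumes "z \<in> int_kernel A" "z \<noteq> 0" "(neg_part z, pos_part z) \<in> r"
  shows "\<exists>u\<in>graver_basis A. (neg_part u, pos_part u) \<in> r \<and> pos_part u \<le> pos_part z"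
  using assms
proof (induction rule: kernel_conformal_induct)
  case (graver u)
  then show ?case
    by blast
next
  case (conformal v w)
  have parts: "pos_part (v + w) = pos_part v + pos_part w" "neg_part (v + w) = neg_part v + neg_part w"
    using conformal.hyps by (simp_all add: conformal_def)
  have le: "pos_part v \<le> pos_part (v + w)" "pos_part w \<le> pos_part (v + w)"
    by (simp_all add: parts less_eq_vec_def)
  show ?case
  proof (cases "(neg_part v, pos_part v) \<in> r \<or> (neg_part w, pos_part w) \<in> r")
    case True
    then show ?thesis
      using conformal.IH le order.trans by blast
  next
    case False
    then have "(pos_part v, neg_part v) \<in> r" "(pos_part w, neg_part w) \<in> r"
      using monomial_order_linear by blast+
    then have "(pos_part v + pos_part w, neg_part v + pos_part w) \<in> r"
      "(neg_part v + pos_part w, neg_part v + neg_part w) \<in> r"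
      using monomial_order_add[of "pos_part w" "neg_part w" "neg_part v"]
      by (simp_all add: monomial_order_add add.commute)
    then have "(pos_part (v + w), neg_part (v + w)) \<in> r"
      unfolding parts by (rule monomial_order_trans)
    then have "pos_part (v + w) = neg_part (v + w)"
      using conformal.prems monomial_order_antisym by blast
    then have sum: "v + w = 0"
      by (simp add: pos_part_eq_neg_part_iff)
    then have "w = - v"
      by (simp add: add_eq_0_iff)
    then have "pos_part v + neg_part v = 0"
      using parts(1) sum by (simp add: pos_part_uminus) (simp add: pos_part_def vec_eq_iff)
    then have "pos_part v = neg_part v"
      by (simp add: vec_eq_iff)
    then show ?thesis
      using conformal.hyps by (simp add: pos_part_eq_neg_part_iff)
  qed
qed

definition oriented_graver_binomials :: "int^'n^'m \<Rightarrow> ('n, 'k::field) mpoly set" where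
  "oriented_graver_binomials A =
     binomial_of ` {u \<in> graver_basis A. (neg_part u, pos_part u) \<in> r}"

text \<open>A fiber meeting the leading monomial of \<open>f\<close> contains a second, smaller monomial of \<open>f\<close>; their
  difference is a kernel vector whose positive part divides the leading monomial.\<close>

lemma graver_lead_below_lead_exp:
  fixes f :: "('n, 'k::field) mpoly"
  assumes "f \<in> toric_ideal A" "f \<noteq> 0"
  shows "\<exists>u\<in>graver_basis A. (neg_part u, pos_part u) \<in> r \<and> pos_part u \<le> lead_exp r f"
proof -
  define a where "a = lead_exp r f"
  obtain b where b: "b \<in> Poly_Mapping.keys f" "b \<noteq> a" "b \<in> fiber A a"
    using toric_ideal_another_key_in_fiber[OF assms(1)] lead_exp_in_keys[OF assms(2)] a_def by blast
  define z where "z = (\<chi> i. int (a $ i) - int (b $ i))"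
  have z: "z \<in> int_kernel A"
    using b(3) by (simp add: z_def fiber_iff)
  have "z \<noteq> 0"
    using b(2) by (auto simp: z_def vec_eq_iff intro: sym)
  have le: "pos_part z \<le> a"
    by (simp add: less_eq_vec_def z_def pos_part_def nat_le_iff)
  have "pos_part z + (a - pos_part z) = a" "neg_part z + (a - pos_part z) = b"
    by (auto simp: vec_eq_iff z_def pos_part_def neg_part_def)
  moreover have "(b, a) \<in> r"
    using lead_exp_greatest[OF assms(2) b(1)] by (simp add: a_def)
  ultimately have "(neg_part z, pos_part z) \<in> r"
    by (metis monomial_order_add_cancel)
  then show ?thesis
    using graver_lead_below_kernel_lead[OF z \<open>z \<noteq> 0\<close>] le order.trans unfolding a_def by blast
qed

lemma groebner_basis_oriented_graver_binomials:
  "groebner_basis r (toric_ideal A :: ('n, 'k::field) mpoly set) (oriented_graver_binomials A)"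
proof -
  let ?G = "oriented_graver_binomials A :: ('n, 'k) mpoly set"
  have finite: "finite ?G"
    by (simp add: oriented_graver_binomials_def finite_graver_basis)
  have sub: "?G \<subseteq> toric_ideal A"
    unfolding toric_ideal_eq_span_graver_basis oriented_graver_binomials_def
    by (auto intro: ideal.span_base)
  have "monomial (lead_exp r f) \<in> initial_ideal r ?G" if f: "f \<in> toric_ideal A - {0}"
    for f :: "('n, 'k) mpoly"
  proof -
    obtain u where u: "u \<in> graver_basis A" "(neg_part u, pos_part u) \<in> r" "pos_part u \<le> lead_exp r f"
      using graver_lead_below_lead_exp f by blast
    then have "u \<noteq> 0"
      by (simp add: graver_basis_def)
    have "(lead_exp r f - pos_part u) + pos_part u = lead_exp r f"
      using u(3) by (simp add: vec_eq_iff less_eq_vec_def)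
    then have "(monomial (lead_exp r f) :: ('n, 'k) mpoly) =
        monomial (lead_exp r f - pos_part u) * monomial (lead_exp r (binomial_of u :: ('n, 'k) mpoly))"
      by (simp add: lead_exp_binomial_of[OF \<open>u \<noteq> 0\<close> u(2)] monomial_mult)
    moreover have "(binomial_of u :: ('n, 'k) mpoly) \<in> ?G - {0}"
      using u keys_binomial_of[OF \<open>u \<noteq> 0\<close>, where 'k = 'k] by (auto simp: oriented_graver_binomials_def)
    ultimately show ?thesis
      unfolding initial_ideal_def by (simp only:) (intro ideal.span_scale ideal.span_base imageI)
  qed
  then have "initial_ideal r (toric_ideal A) \<subseteq> initial_ideal r ?G"
    unfolding initial_ideal_def[of r "toric_ideal A"]
    by (intro ideal.span_minimal) (auto simp: initial_ideal_def)
  moreover have "initial_ideal r ?G \<subseteq> initial_ideal r (toric_ideal A)"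
    unfolding initial_ideal_def using sub by (intro ideal.span_mono image_mono) blast
  ultimately show ?thesis
    using finite sub by (auto simp: groebner_basis_def)
qed

text \<open>If the leading monomial of the binomial of \<open>v\<close> divides a monomial of the binomial of \<open>u\<close>, then
  subtracting \<open>v\<close> from \<open>u\<close> or from \<open>- u\<close> is a semiconformal decomposition.\<close>

lemma reduced_groebner_basis_oriented_graver_binomials:
  assumes indecomposable: "\<And>u. u \<in> graver_basis A \<Longrightarrow> \<not> semiconformally_decomposable {} A u"
  shows "reduced_groebner_basis r (toric_ideal A :: ('n, 'k::field) mpoly set)
    (oriented_graver_binomials A)"
  unfolding reduced_groebner_basis_def
proof (intro conjI ballI)
  let ?G = "oriented_graver_binomials A :: ('n, 'k) mpoly set"
  show "groebner_basis r (toric_ideal A) ?G"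
    by (rule groebner_basis_oriented_graver_binomials)
  fix g assume "g \<in> ?G"
  then obtain u where g: "g = binomial_of u" and u: "u \<in> graver_basis A" "(neg_part u, pos_part u) \<in> r"
    by (auto simp: oriented_graver_binomials_def)
  have "u \<noteq> 0"
    using u by (simp add: graver_basis_def)
  then have "pos_part u \<noteq> neg_part u"
    by (simp add: pos_part_eq_neg_part_iff)
  then show "Poly_Mapping.lookup g (lead_exp r g) = 1"
    unfolding g lead_exp_binomial_of[OF \<open>u \<noteq> 0\<close> u(2)]
    by (simp add: binomial_of_def monomial_def lookup_minus lookup_single when_def)
  fix h a assume "h \<in> ?G - {g}" and "a \<in> Poly_Mapping.keys g"
  then obtain v where h: "h = binomial_of v" "v \<noteq> u" and
    v: "v \<in> graver_basis A" "(neg_part v, pos_part v) \<in> r"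
    using g by (auto simp: oriented_graver_binomials_def)
  have "v \<noteq> 0"
    using v by (simp add: graver_basis_def)
  have "v \<noteq> - u"
    using u(2) v(2) \<open>pos_part u \<noteq> neg_part u\<close> monomial_order_antisym
    by (auto simp: pos_part_uminus neg_part_uminus)
  have "a = pos_part u \<or> a = pos_part (- u)"
    using \<open>a \<in> Poly_Mapping.keys g\<close> by (simp add: g keys_binomial_of[OF \<open>u \<noteq> 0\<close>] pos_part_uminus)
  then obtain u' where u': "u' = u \<or> u' = - u" "a = pos_part u'"
    by blast
  then have "u' \<in> graver_basis A" "v \<noteq> u'"
    using u(1) h(2) \<open>v \<noteq> - u\<close> uminus_in_graver_basis by auto
  then have "\<not> pos_part v \<le> pos_part u'"
    using indecomposable semiconformally_decomposableI v(1) \<open>v \<noteq> 0\<close> unfolding graver_basis_def by blast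
  then show "\<not> lead_exp r h \<le> a"
    by (simp add: h(1) lead_exp_binomial_of[OF \<open>v \<noteq> 0\<close> v(2)] u'(2))
qed

lemma sign_closure_oriented_graver_binomials:
  "sign_closure (oriented_graver_binomials A) =
    (binomial_of ` graver_basis A :: ('n, 'k::field) mpoly set)"
proof
  show "sign_closure (oriented_graver_binomials A) \<subseteq>
      (binomial_of ` graver_basis A :: ('n, 'k) mpoly set)"
    by (auto simp: sign_closure_def oriented_graver_binomials_def uminus_in_graver_basis
        simp flip: binomial_of_uminus)
  show "(binomial_of ` graver_basis A :: ('n, 'k) mpoly set) \<subseteq>
      sign_closure (oriented_graver_binomials A)"
  proof (rule image_subsetI)
    fix u assume u: "u \<in> graver_basis A"
    have "(binomial_of u :: ('n, 'k) mpoly) = - binomial_of (- u)"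
      by (simp add: binomial_of_uminus)
    moreover have "binomial_of u \<in> oriented_graver_binomials A \<or>
        (binomial_of (- u) :: ('n, 'k) mpoly) \<in> oriented_graver_binomials A"
      using u uminus_in_graver_basis[OF u] monomial_order_linear[of "pos_part u" "neg_part u"]
      by (auto simp: oriented_graver_binomials_def pos_part_uminus neg_part_uminus)
    ultimately show "(binomial_of u :: ('n, 'k) mpoly) \<in> sign_closure (oriented_graver_binomials A)"
      unfolding sign_closure_def by (metis UnI1 UnI2 imageI)
  qed
qed

end

text \<open>Some monomial order must exist, since otherwise the universal Groebner basis would be an
  empty union.\<close>

lemma lexicographic_order_is_monomial_order:
  fixes L :: "(nat^'n::{finite,linorder}) rel"
  defines "L \<equiv> {(a, b). a = b \<or> (\<exists>i. a $ i < b $ i \<and> (\<forall>j<i. a $ j = b $ j))}"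
  shows "monomial_order L"
proof -
  have first_difference: "\<exists>i. a $ i \<noteq> b $ i \<and> (\<forall>j<i. a $ j = b $ j)" if neq: "a \<noteq> b" 
    for a b :: "nat^'n::{finite,linorder}"
  proof -
    let ?D = "{i. a $ i \<noteq> b $ i}"
    have "?D \<noteq> {}"
      using neq by (auto simp: vec_eq_iff)
    then have "Min ?D \<in> ?D" "\<forall>j<Min ?D. j \<notin> ?D"
      using Min_in[of ?D] Min_le[of ?D] by (auto simp: not_less[symmetric])
    then show ?thesis
      by blast
  qed
  have total: "(a, b) \<in> L \<or> (b, a) \<in> L" for a b
    using first_difference[of a b] by (fastforce simp: L_def neq_iff)
  have antisym: "a = b" if le: "(a, b) \<in> L" "(b, a) \<in> L" for a b
  proof (rule ccontr)
    assume "a \<noteq> b"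
    then obtain i j where "a $ i < b $ i" "\<forall>k<i. a $ k = b $ k" "b $ j < a $ j" "\<forall>k<j. b $ k = a $ k"
      using le by (auto simp: L_def)
    then show False
      by (metis less_irrefl linorder_neqE order_less_asym)
  qed
  have trans: "(a, d) \<in> L" if le: "(a, b) \<in> L" "(b, d) \<in> L" for a b d
  proof (cases "a = b \<or> b = d")
    case False
    then obtain i j where "a $ i < b $ i" "\<forall>k<i. a $ k = b $ k" "b $ j < d $ j" "\<forall>k<j. b $ k = d $ k"
      using le by (auto simp: L_def)
    then have "a $ min i j < d $ min i j" "\<forall>k<min i j. a $ k = d $ k"
      by (cases i j rule: linorder_cases; simp)+
    then show ?thesis
      unfolding L_def by blast
  qed (use le in auto)
  have zero: "(0, a) \<in> L" for a
    using first_difference[of 0 a] by (auto simp: L_def)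
  have "(a + d, b + d) \<in> L" if "(a, b) \<in> L" for a b d
    using that by (auto simp: L_def)
  moreover have "linear_order L"
    unfolding order_on_defs refl_on_def total_on_def
    using total antisym trans by (auto intro!: transI antisymI)
  ultimately show ?thesis
    using zero by (simp add: monomial_order_def)
qed

text \<open>If the Graver basis is indecomposable, then for each monomial order the unique reduced Groebner
  basis consists of the Graver binomials, oriented by the order. Conversely, the clause on minimal
  Markov bases determines the set of indispensable binomials.\<close>

lemma bases_coincide_iff_strongly_robust:
  fixes A :: "int^'n::{finite,linorder}^'m"
  shows "bases_coincide TYPE('k::field) A \<longleftrightarrow> strongly_robust TYPE('k) A"
proof
  assume "bases_coincide TYPE('k) A"
  then have "sign_closure M = graver_basis A" if "minimal_markov_basis TYPE('k) A M" for M
    using that sign_closure_graver_basis[of A] by (simp add: bases_coincide_def eq_up_to_sign_def)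
  moreover obtain M where "minimal_markov_basis TYPE('k) A M"
    using minimal_markov_basis_subset[OF graver_basis_is_markov_basis] by blast
  ultimately have "indispensable TYPE('k) A = graver_basis A"
    unfolding indispensable_def by blast
  then show "strongly_robust TYPE('k) A"
    by (simp add: strongly_robust_def eq_up_to_sign_def)
next
  assume "strongly_robust TYPE('k) A"
  then have indecomposable: "\<And>u. u \<in> graver_basis A \<Longrightarrow> \<not> semiconformally_decomposable {} A u"
    by (simp add: strongly_robust_iff_indecomposable)
  let ?I = "toric_ideal A :: ('n, 'k) mpoly set"
  let ?B = "binomial_of ` graver_basis A :: ('n, 'k) mpoly set"
  have reduced_iff: "reduced_groebner_basis r ?I G \<longleftrightarrow> G = oriented_graver_binomials r A"
    if "monomial_order r" for r G
    using reduced_groebner_basis_unique[OF that, of ?I] ideal.subspace_span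
      reduced_groebner_basis_oriented_graver_binomials[OF that indecomposable]
    unfolding toric_ideal_def by metis
  have closed: "sign_closure ?B = ?B"
    by (auto simp: sign_closure_def uminus_in_graver_basis simp flip: binomial_of_uminus)
  have "universal_groebner_basis ?I = (\<Union>r\<in>{r. monomial_order r}. oriented_graver_binomials r A)"
    unfolding universal_groebner_basis_def using reduced_iff by blast
  then have "sign_closure (universal_groebner_basis ?I) =
      (\<Union>r\<in>{r. monomial_order r}. sign_closure (oriented_graver_binomials r A))"
    by (simp only: sign_closure_def image_UN UN_Un_distrib)
  also have "\<dots> = ?B"
    using sign_closure_oriented_graver_binomials lexicographic_order_is_monomial_order by blast
  finally have "eq_up_to_sign (universal_groebner_basis ?I) ?B"
    by (simp add: eq_up_to_sign_def closed)
  moreover have "eq_up_to_sign M (graver_basis A)" if "minimal_markov_basis TYPE('k) A M" for M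
    using minimal_markov_basis_eq_graver_basis[OF indecomposable that] sign_closure_graver_basis[of A]
    by (simp add: eq_up_to_sign_def)
  moreover have "eq_up_to_sign G ?B" if "monomial_order r" "reduced_groebner_basis r ?I G" for r G
    using that sign_closure_oriented_graver_binomials[OF that(1), of A]
    by (simp add: reduced_iff eq_up_to_sign_def closed)
  ultimately show "bases_coincide TYPE('k) A"
    by (simp add: bases_coincide_def)
qed


section \<open>Bouquets\<close>

lemma covector_orthogonal_kernel:
  fixes A :: "int^'n::finite^'m::finite"
  assumes "u \<in> covectors A" "z \<in> int_kernel A"
  shows "(\<Sum>i\<in>support u. u $ i * z $ i) = 0"
proof -
  obtain v where u: "u = v v* A"
    using assms(1) by (auto simp: covectors_def)
  have Az: "(\<Sum>i\<in>UNIV. A $ l $ i * z $ i) = 0" for l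
    using assms(2) by (simp add: int_kernel_def matrix_vector_mult_def vec_eq_iff)
  have "(\<Sum>i\<in>support u. u $ i * z $ i) = (\<Sum>i\<in>UNIV. u $ i * z $ i)"
    by (rule sum.mono_neutral_left) (auto simp: support_def)
  also have "\<dots> = (\<Sum>i\<in>UNIV. \<Sum>l\<in>UNIV. v $ l * (A $ l $ i * z $ i))"
    by (simp add: u vector_matrix_mult_def sum_distrib_left sum_distrib_right mult_ac)
  also have "\<dots> = (\<Sum>l\<in>UNIV. v $ l * (\<Sum>i\<in>UNIV. A $ l $ i * z $ i))"
    by (subst sum.swap) (simp only: sum_distrib_left)
  finally show ?thesis
    by (simp add: Az)
qed

lemma kernel_zero_on_free_vectors:
  fixes A :: "int^'n::finite^'m::finite"
  assumes "i \<in> free_vectors A" "z \<in> int_kernel A"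
  shows "z $ i = 0"
proof -
  obtain u where u: "u \<in> covectors A" "support u = {i}"
    using assms(1) by (auto simp: free_vectors_def cocircuits_def)
  then have "u $ i \<noteq> 0"
    by (auto simp: support_def)
  then show ?thesis
    using covector_orthogonal_kernel[OF u(1) assms(2)] u(2) by simp
qed

lemma edge_covector_orthogonal_kernel:
  fixes A :: "int^'n::finite^'m::finite"
  assumes "u \<in> covectors A" "support u = {i, j}" "i \<noteq> j" "z \<in> int_kernel A"
  shows "u $ i * z $ i + u $ j * z $ j = 0"
  using covector_orthogonal_kernel[OF assms(1,4)] assms(2,3) by simp

text \<open>An edge co-vector is a linear relation, with nonzero coefficients, between two coordinates that
  holds on the whole kernel; such relations compose along a path.\<close>

lemma connected_coordinates_proportional:
  fixes A :: "int^'n::finite^'m::finite"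
  assumes "(i, j) \<in> (bouquet_edges A)\<^sup>*"
  shows "\<exists>p q. p \<noteq> 0 \<and> q \<noteq> 0 \<and> (\<forall>z\<in>int_kernel A. p * z $ i = q * z $ j)"
  using assms
proof (induction rule: rtrancl_induct)
  case base
  show ?case
    by (intro exI[of _ 1]) simp
next
  case (step j k)
  then obtain p q where pq: "p \<noteq> 0" "q \<noteq> 0" "\<forall>z\<in>int_kernel A. p * z $ i = q * z $ j"
    by blast
  obtain u where u: "u \<in> covectors A" "support u = {j, k}" "j \<noteq> k"
    using step.hyps(2) by (auto simp: bouquet_edges_def)
  have "p * u $ j * z $ i = - q * u $ k * z $ k" if "z \<in> int_kernel A" for z
  proof -
    have "u $ j * z $ j = - (u $ k * z $ k)"
      using edge_covector_orthogonal_kernel[OF u that] by simp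
    moreover have "p * u $ j * z $ i = q * (u $ j * z $ j)"
      using pq(3) that by simp
    ultimately show ?thesis
      by simp
  qed
  moreover have "p * u $ j \<noteq> 0" "- q * u $ k \<noteq> 0"
    using pq u(2) by (auto simp: support_def)
  ultimately show ?case
    by blast
qed

lemma equiv_bouquet_connected: "equiv UNIV ((bouquet_edges A)\<^sup>*)"
proof (rule equivI)
  have "sym (bouquet_edges A)"
    by (auto simp: sym_def bouquet_edges_def insert_commute)
  then show "sym ((bouquet_edges A)\<^sup>*)"
    by (rule sym_rtrancl)
qed (simp_all add: refl_rtrancl trans_rtrancl)

lemma bouquet_connected:
  assumes "B \<in> bouquets A" "i \<in> B"
  shows "j \<in> B \<longleftrightarrow> (i, j) \<in> (bouquet_edges A)\<^sup>*"
  using in_quotient_imp_in_rel[OF equiv_bouquet_connected, of B A i j]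
    in_quotient_imp_closed[OF equiv_bouquet_connected, of B A i j] assms
  by (auto simp only: bouquets_def insert_subset empty_subsetI)

lemma bouquet_nonempty: "B \<in> bouquets A \<Longrightarrow> B \<noteq> {}"
  unfolding bouquets_def using in_quotient_imp_non_empty[OF equiv_bouquet_connected] by blast

lemma bouquets_disjoint:
  "B \<in> bouquets A \<Longrightarrow> B' \<in> bouquets A \<Longrightarrow> i \<in> B \<Longrightarrow> i \<in> B' \<Longrightarrow> B = B'"
  unfolding bouquets_def using quotient_disj[OF equiv_bouquet_connected] by blast

lemma bouquets_cover: "\<exists>B\<in>bouquets A. i \<in> B"
  unfolding bouquets_def using Union_quotient[OF equiv_bouquet_connected] by blast

lemma sgn_eq_iff_if_orthogonal:
  fixes a b x y :: int
  assumes "a * x + b * y = 0" "a \<noteq> 0" "b \<noteq> 0" "x \<noteq> 0" "y \<noteq> 0"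
  shows "sgn x = sgn y \<longleftrightarrow> sgn a \<noteq> sgn b"
proof -
  have "sgn (a * x) = sgn (- (b * y))"
    using assms(1) by (metis add_eq_0_iff add.commute)
  then have "sgn a * sgn x = - (sgn b * sgn y)"
    by (simp add: sgn_mult)
  then show ?thesis
    using assms(2-) by (auto simp: sgn_if split: if_splits)
qed

text \<open>The kernel vector \<open>z\<close> vanishes nowhere on \<open>B\<close>, as a Gale coordinate of a non-free
  bouquet does, so no co-vector is supported on a single vertex of \<open>B\<close>; hence every edge co-vector is a co-circuit, and an edge that is not in
  \<open>E\<^sub>A\<^sup>-\<close> forces equal signs on \<open>z\<close>.\<close>

lemma same_sign_if_no_neg_edge:
  fixes A :: "int^'n::finite^'m::finite"
  assumes B: "B \<in> bouquets A" and no_neg: "\<forall>i\<in>B. \<forall>j\<in>B. (i, j) \<notin> neg_edges A"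
    and z: "z \<in> int_kernel A" "\<forall>i\<in>B. z $ i \<noteq> 0"
    and ij: "i \<in> B" "j \<in> B"
  shows "sgn (z $ i) = sgn (z $ j)"
proof -
  have "(i, j) \<in> (bouquet_edges A)\<^sup>*"
    using bouquet_connected[OF B ij(1)] ij(2) by simp
  then show ?thesis
  proof (induction rule: rtrancl_induct)
    case (step j k)
    then have jk: "j \<in> B" "k \<in> B"
      using bouquet_connected[OF B ij(1)] by (auto intro: rtrancl.rtrancl_into_rtrancl)
    obtain u where u: "u \<in> covectors A" "support u = {j, k}" "j \<noteq> k"
      using step.hyps(2) by (auto simp: bouquet_edges_def)
    have "support w = {j, k}" if w: "w \<in> covectors A" "w \<noteq> 0" "support w \<subseteq> {j, k}" for w
    proof (rule ccontr)
      assume "support w \<noteq> {j, k}"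
      moreover have "support w \<noteq> {}"
        using w(2) by (auto simp: support_def vec_eq_iff)
      ultimately obtain l where l: "l \<in> {j, k}" "support w = {l}"
        using w(3) by blast
      then have "w $ l \<noteq> 0"
        by (auto simp: support_def)
      moreover have "w $ l * z $ l = 0"
        using covector_orthogonal_kernel[OF w(1) z(1)] l(2) by simp
      ultimately show False
        using l(1) jk z(2) by auto
    qed
    moreover have nonzero: "u $ j \<noteq> 0" "u $ k \<noteq> 0"
      using u(2) by (auto simp: support_def)
    then have "u \<noteq> 0"
      by auto
    ultimately have "u \<in> cocircuits A"
      using u(1,2) unfolding cocircuits_def by blast
    then have "sgn (u $ j) \<noteq> sgn (u $ k)"
      using no_neg jk u(2,3) by (auto simp: neg_edges_def)
    then have "sgn (z $ j) = sgn (z $ k)"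
      using sgn_eq_iff_if_orthogonal[OF edge_covector_orthogonal_kernel[OF u z(1)]]
        nonzero jk z(2) by blast
    with step.IH show ?case
      by simp
  qed simp
qed

text \<open>Up to a sign \<open>\<epsilon>\<close>, the vector \<open>c\<close> is a kernel vector \<open>z\<close> restricted to \<open>B\<close> and made primitive; the
  equation is multiplied by the gcd \<open>g\<close> so that later arguments need no division.\<close>

lemma nonfree_bouquet_vectorE:
  fixes A :: "int^'n::{finite,linorder}^'m::finite"
  assumes "lattice_basis (int_kernel A) Gs" and B: "B \<in> bouquets A" "\<not> free_bouquet A B"
    and "is_bouquet_vector A Gs B c"
  obtains z g \<epsilon> where "z \<in> int_kernel A" "\<forall>i\<in>B. z $ i \<noteq> 0" "g = Gcd ((\<lambda>i. z $ i) ` B)" "g > 0"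
    "\<epsilon> * \<epsilon> = 1" "\<epsilon> * z $ Min B > 0" "\<forall>i\<in>B. c $ i * g = \<epsilon> * z $ i" "\<forall>i. i \<notin> B \<longrightarrow> c $ i = 0"
proof -
  obtain j where j: "j < length Gs" "\<forall>i\<in>B. gale Gs i j \<noteq> 0"
    and c: "c = (\<chi> i. if i \<in> B
      then sgn (gale Gs (Min B) j) * (gale Gs i j div Gcd ((\<lambda>i. gale Gs i j) ` B)) else 0)"
    using assms(4) B(2) by (auto simp: is_bouquet_vector_def)
  define z where "z = Gs ! j"
  define g where "g = Gcd ((\<lambda>i. z $ i) ` B)"
  define \<epsilon> where "\<epsilon> = sgn (z $ Min B)"
  have gale: "gale Gs i j = z $ i" for i
    by (simp add: gale_def z_def)
  have nonzero: "\<forall>i\<in>B. z $ i \<noteq> 0"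
    using j(2) by (simp add: gale)
  have "Min B \<in> B"
    using bouquet_nonempty[OF B(1)] by (intro Min_in) simp_all
  then have "z $ Min B \<noteq> 0"
    using nonzero by blast
  then have "\<epsilon> * \<epsilon> = 1" "\<epsilon> * z $ Min B > 0"
    by (auto simp: \<epsilon>_def sgn_if)
  moreover have "z \<in> int_kernel A"
    using assms(1) j(1) int_vec.span_base[of z "set Gs"] by (auto simp: lattice_basis_def z_def)
  moreover have "g \<noteq> 0"
    using nonzero \<open>Min B \<in> B\<close> by (auto simp: g_def)
  then have "g > 0"
    using Gcd_int_greater_eq_0[of "(\<lambda>i. z $ i) ` B"] unfolding g_def by linarith
  moreover have "c $ i * g = \<epsilon> * z $ i" if "i \<in> B" for i
  proof -
    have "g dvd z $ i"
      using that by (auto simp: g_def)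
    then show ?thesis
      using that by (simp add: c gale g_def \<epsilon>_def)
  qed
  moreover have "\<forall>i. i \<notin> B \<longrightarrow> c $ i = 0"
    by (simp add: c)
  ultimately show ?thesis
    using that nonzero g_def by blast
qed

lemma bouquet_vector_support:
  fixes A :: "int^'n::{finite,linorder}^'m::finite"
  assumes "lattice_basis (int_kernel A) Gs" "B \<in> bouquets A" "is_bouquet_vector A Gs B c"
  shows "support c = B"
proof (cases "free_bouquet A B")
  case True
  then show ?thesis
    using assms(3) by (simp add: is_bouquet_vector_def)
next
  case False
  from nonfree_bouquet_vectorE[OF assms(1,2) False assms(3)] obtain z g \<epsilon> where
    *: "\<forall>i\<in>B. z $ i \<noteq> 0" "(\<epsilon> :: int) * \<epsilon> = 1" "\<forall>i\<in>B. c $ i * g = \<epsilon> * z $ i"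
      "\<forall>i. i \<notin> B \<longrightarrow> c $ i = 0"
    by metis
  then have "c $ i \<noteq> 0" if "i \<in> B" for i
    using that by (metis mult_eq_0_iff zero_neq_one)
  with * show ?thesis
    by (auto simp: support_def)
qed

text \<open>On a non-free bouquet all kernel vectors are proportional to \<open>c\<close>; the multiple is integral
  because \<open>c\<close> is primitive.\<close>

lemma kernel_multiple_of_bouquet_vector:
  fixes A :: "int^'n::{finite,linorder}^'m::finite"
  assumes basis: "lattice_basis (int_kernel A) Gs" and B: "B \<in> bouquets A"
    and c: "is_bouquet_vector A Gs B c" and x: "x \<in> int_kernel A"
  shows "\<exists>k. \<forall>i\<in>B. x $ i = k * c $ i"
proof (cases "free_bouquet A B")
  case True
  then have "\<forall>i\<in>B. x $ i = 0 * c $ i"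
    using kernel_zero_on_free_vectors[OF _ x] by (auto simp: free_bouquet_def)
  then show ?thesis
    by blast
next
  case False
  obtain z g \<epsilon> where z: "z \<in> int_kernel A" "\<forall>i\<in>B. z $ i \<noteq> 0" and
    g: "g = Gcd ((\<lambda>i. z $ i) ` B)" "g > 0" and \<epsilon>: "\<epsilon> * \<epsilon> = 1" "\<forall>i\<in>B. c $ i * g = \<epsilon> * z $ i"
    using nonfree_bouquet_vectorE[OF basis B False c] by metis
  obtain l where l: "l \<in> B"
    using bouquet_nonempty[OF B] by blast
  have proportional: "x $ i * z $ l = z $ i * x $ l" if i: "i \<in> B" for i
  proof -
    obtain p q where "p \<noteq> 0" "q \<noteq> 0" "\<forall>z\<in>int_kernel A. p * z $ i = q * z $ l"
      using connected_coordinates_proportional bouquet_connected[OF B i] l by blast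
    then have "p * x $ i = q * x $ l" "p * z $ i = q * z $ l" "q \<noteq> 0" "p \<noteq> 0"
      using x z(1) by blast+
    then have "p * (x $ i * z $ l) = p * (z $ i * x $ l)"
      by (metis mult.assoc mult.commute)
    with \<open>p \<noteq> 0\<close> show ?thesis
      by simp
  qed
  have "z $ l dvd Gcd ((*) (x $ l) ` (\<lambda>i. z $ i) ` B)"
  proof (rule Gcd_greatest)
    fix y assume "y \<in> (*) (x $ l) ` (\<lambda>i. z $ i) ` B"
    then obtain i where "i \<in> B" "y = x $ l * z $ i"
      by blast
    then have "y = x $ i * z $ l"
      using proportional by (simp add: mult.commute)
    then show "z $ l dvd y"
      by simp
  qed
  then have "z $ l dvd x $ l * g"
    by (simp add: Gcd_mult g(1))
  then obtain k where k: "x $ l * g = k * z $ l"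
    by (metis dvdE mult.commute)
  have "x $ i = k * \<epsilon> * c $ i" if i: "i \<in> B" for i
  proof -
    have "z $ l * (g * x $ i) = g * (x $ i * z $ l)"
      by (simp add: mult_ac)
    also have "\<dots> = z $ i * (x $ l * g)"
      by (simp add: proportional[OF i] mult_ac)
    also have "\<dots> = z $ l * (k * z $ i)"
      unfolding k by (simp add: mult_ac)
    finally have "g * x $ i = k * z $ i"
      using z(2) l by simp
    also have "\<dots> = k * \<epsilon> * (\<epsilon> * z $ i)"
      using \<epsilon>(1) by (metis mult.assoc mult_1_right)
    also have "\<dots> = g * (k * \<epsilon> * c $ i)"
      using \<epsilon>(2) i by (metis mult.assoc mult.commute)
    finally show ?thesis
      using g(2) by simp
  qed
  then show ?thesis
    by blast
qed

text \<open>The vector \<open>c\<close> of a non-free bouquet has the sign pattern of a kernel vector, up to one sign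
  that makes its first entry positive.\<close>

lemma nonmixed_bouquet_vector_positive:
  fixes A :: "int^'n::{finite,linorder}^'m::finite"
  assumes basis: "lattice_basis (int_kernel A) Gs" and B: "B \<in> bouquets A" "\<not> free_bouquet A B"
    and c: "is_bouquet_vector A Gs B c" and nonmixed: "\<not> mixed_bouquet A B" and i: "i \<in> B"
  shows "c $ i > 0"
proof -
  obtain z g \<epsilon> where z: "z \<in> int_kernel A" "\<forall>i\<in>B. z $ i \<noteq> 0" and
    g: "g > 0" and \<epsilon>: "\<epsilon> * z $ Min B > 0" "\<forall>i\<in>B. c $ i * g = \<epsilon> * z $ i"
    using nonfree_bouquet_vectorE[OF basis B c] by metis
  have "Min B \<in> B"
    using i by (intro Min_in) auto
  then have "sgn (z $ i) = sgn (z $ Min B)"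
    using same_sign_if_no_neg_edge[OF B(1) _ z i] nonmixed B by (auto simp: mixed_bouquet_def)
  then have "\<epsilon> * z $ i > 0"
    using \<epsilon>(1) by (metis sgn_mult sgn_greater)
  then show ?thesis
    using \<epsilon>(2) i g by (metis zero_less_mult_pos2)
qed

lemma mixed_bouquet_vector_both_signs:
  fixes A :: "int^'n::{finite,linorder}^'m::finite"
  assumes basis: "lattice_basis (int_kernel A) Gs" and mixed: "mixed_bouquet A B"
    and c: "is_bouquet_vector A Gs B c"
  shows "\<exists>i\<in>B. \<exists>j\<in>B. c $ i > 0 \<and> c $ j < 0"
proof -
  have B: "B \<in> bouquets A" "\<not> free_bouquet A B"
    using mixed by (auto simp: mixed_bouquet_def)
  obtain z g \<epsilon> where z: "z \<in> int_kernel A" "\<forall>i\<in>B. z $ i \<noteq> 0" and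
    g: "g > 0" and \<epsilon>: "\<epsilon> * \<epsilon> = 1" "\<forall>i\<in>B. c $ i * g = \<epsilon> * z $ i"
    using nonfree_bouquet_vectorE[OF basis B c] by metis
  obtain i j u where ij: "i \<in> B" "j \<in> B" "i \<noteq> j" and
    u: "u \<in> covectors A" "support u = {i, j}" "sgn (u $ i) = sgn (u $ j)"
    using mixed by (auto simp: mixed_bouquet_def neg_edges_def cocircuits_def)
  have "u $ i \<noteq> 0" "u $ j \<noteq> 0"
    using u(2) by (auto simp: support_def)
  then have "sgn (z $ i) \<noteq> sgn (z $ j)"
    using sgn_eq_iff_if_orthogonal[OF edge_covector_orthogonal_kernel[OF u(1,2) ij(3) z(1)]]
      u(3) ij z(2) by blast
  moreover have "sgn (c $ l) = sgn \<epsilon> * sgn (z $ l)" if "l \<in> B" for l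
    using \<epsilon>(2) that g by (metis mult_1_right sgn_1_pos sgn_mult sgn_pos)
  moreover have "sgn \<epsilon> \<noteq> 0"
    using \<epsilon>(1) by (metis mult_zero_left sgn_eq_0_iff zero_neq_one)
  ultimately have "sgn (c $ i) \<noteq> sgn (c $ j)"
    using ij by simp
  moreover have "c $ i \<noteq> 0" "c $ j \<noteq> 0"
    using bouquet_vector_support[OF basis B(1) c] ij by (auto simp: support_def)
  ultimately have "c $ i > 0 \<and> c $ j < 0 \<or> c $ j > 0 \<and> c $ i < 0"
    by (auto simp: sgn_if split: if_splits)
  then show ?thesis
    using ij by blast
qed


section \<open>The lift of kernel vectors along the bouquets\<close>

text \<open>The map \<open>u \<mapsto> \<Sum>\<^sub>k u\<^sub>k c\<^sub>k\<close>, which identifies the kernel of the bouquet matrix with the kernel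
  of \<open>A\<close>: the supports of the vectors \<open>c\<^sub>k\<close> partition the coordinates, and on each bouquet every
  kernel vector of \<open>A\<close> is an integral multiple of \<open>c\<^sub>k\<close>.\<close>

definition bouquet_lift :: "('s::finite \<Rightarrow> int^'n) \<Rightarrow> int^'s \<Rightarrow> int^'n" where
  "bouquet_lift c u = (\<chi> i. \<Sum>k\<in>UNIV. u $ k * c k $ i)"

lemma bouquet_lift_add: "bouquet_lift c (u + v) = bouquet_lift c u + bouquet_lift c v"
  by (simp add: bouquet_lift_def vec_eq_iff distrib_right sum.distrib)

lemma bouquet_matrix_mult_eq: "bouquet_matrix A c *v u = A *v bouquet_lift c u"
proof -
  have "(bouquet_matrix A c *v u) $ l = (A *v bouquet_lift c u) $ l" for l
  proof -
    have "(bouquet_matrix A c *v u) $ l = (\<Sum>k\<in>UNIV. \<Sum>i\<in>UNIV. A $ l $ i * (u $ k * c k $ i))"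
      by (simp add: bouquet_matrix_def matrix_vector_mult_def column_def sum_distrib_left
          sum_distrib_right mult_ac)
    also have "\<dots> = (\<Sum>i\<in>UNIV. \<Sum>k\<in>UNIV. A $ l $ i * (u $ k * c k $ i))"
      by (rule sum.swap)
    also have "\<dots> = (A *v bouquet_lift c u) $ l"
      by (simp add: bouquet_lift_def matrix_vector_mult_def sum_distrib_left)
    finally show ?thesis .
  qed
  then show ?thesis
    by (simp add: vec_eq_iff)
qed

lemma bouquet_lift_in_kernel_iff:
  "bouquet_lift c u \<in> int_kernel A \<longleftrightarrow> u \<in> int_kernel (bouquet_matrix A c)"
  by (simp add: int_kernel_def bouquet_matrix_mult_eq)

context
  fixes A :: "int^'n::{finite,linorder}^'m::finite"
    and Gs :: "(int^'n::{finite,linorder}) list"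
    and B :: "'s::finite \<Rightarrow> 'n set"
    and c :: "'s \<Rightarrow> int^'n::{finite,linorder}"
  assumes basis: "lattice_basis (int_kernel A) Gs"
    and enum: "bij_betw B UNIV (bouquets A)"
    and vecs: "\<And>k. is_bouquet_vector A Gs (B k) (c k)"
begin

lemma enumerated_bouquet: "B k \<in> bouquets A"
  using enum by (auto simp: bij_betw_def)

lemma enumerated_support: "support (c k) = B k"
  using bouquet_vector_support[OF basis enumerated_bouquet vecs] .

lemma bouquet_lift_nth:
  assumes "i \<in> B k"
  shows "bouquet_lift c u $ i = u $ k * c k $ i"
proof -
  have "(\<Sum>l\<in>UNIV - {k}. u $ l * c l $ i) = 0"
  proof (rule sum.neutral, rule ballI)
    fix l assume l: "l \<in> UNIV - {k}"
    have "B l \<noteq> B k"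
      using l enum by (auto simp: bij_betw_def inj_eq)
    then have "i \<notin> support (c l)"
      using bouquets_disjoint[OF enumerated_bouquet enumerated_bouquet _ assms]
      by (auto simp: enumerated_support)
    then show "u $ l * c l $ i = 0"
      by (simp add: support_def)
  qed
  then show ?thesis
    by (simp add: bouquet_lift_def sum.remove[of UNIV k])
qed

lemma in_some_enumerated_bouquet: "\<exists>k. i \<in> B k"
  using bouquets_cover[of A i] enum by (auto simp: bij_betw_def)

lemma enumerated_bouquet_member:
  obtains i where "i \<in> B k" "c k $ i \<noteq> 0"
  using bouquet_nonempty[OF enumerated_bouquet] enumerated_support by (force simp: support_def)

lemma bouquet_lift_eq_iff: "bouquet_lift c u = bouquet_lift c v \<longleftrightarrow> u = v"
proof
  assume eq: "bouquet_lift c u = bouquet_lift c v"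
  have "u $ k = v $ k" for k
  proof -
    obtain i where i: "i \<in> B k" "c k $ i \<noteq> 0"
      by (rule enumerated_bouquet_member)
    then show ?thesis
      using eq bouquet_lift_nth[OF i(1), of u] bouquet_lift_nth[OF i(1), of v] by simp
  qed
  then show "u = v"
    by (simp add: vec_eq_iff)
qed simp

lemma bouquet_lift_zero: "bouquet_lift c 0 = 0"
  by (simp add: bouquet_lift_def vec_eq_iff)

lemma bouquet_lift_surj:
  assumes "z \<in> int_kernel A"
  shows "\<exists>u\<in>int_kernel (bouquet_matrix A c). bouquet_lift c u = z"
proof -
  have "\<forall>k. \<exists>m. \<forall>i\<in>B k. z $ i = m * c k $ i"
    using kernel_multiple_of_bouquet_vector[OF basis enumerated_bouquet vecs assms] by blast
  then obtain m where m: "\<And>k i. i \<in> B k \<Longrightarrow> z $ i = m k * c k $ i"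
    by metis
  have "bouquet_lift c (\<chi> k. m k) $ i = z $ i" for i
  proof -
    obtain k where "i \<in> B k"
      using in_some_enumerated_bouquet by blast
    then show ?thesis
      by (simp add: bouquet_lift_nth m)
  qed
  then have "bouquet_lift c (\<chi> k. m k) = z"
    by (simp add: vec_eq_iff)
  then show ?thesis
    using assms bouquet_lift_in_kernel_iff by metis
qed

lemma kernel_zero_on_free_bouquet:
  assumes "free_bouquet A (B k)" "u \<in> int_kernel (bouquet_matrix A c)"
  shows "u $ k = 0"
proof -
  obtain i where i: "i \<in> B k" "c k $ i \<noteq> 0"
    by (rule enumerated_bouquet_member)
  then have "i \<in> free_vectors A"
    using assms(1) by (simp add: free_bouquet_def)
  then have "bouquet_lift c u $ i = 0"
    using kernel_zero_on_free_vectors assms(2) bouquet_lift_in_kernel_iff by blast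
  then show ?thesis
    using i(2) by (simp add: bouquet_lift_nth[OF i(1)])
qed

text \<open>On the bouquet \<open>B k\<close> both vectors are multiplied by the same nonzero numbers, and having equal
  weak signs is insensitive to that.\<close>

lemma conformal_bouquet_lift_iff:
  "conformal (bouquet_lift c (v + w)) (bouquet_lift c v) (bouquet_lift c w) \<longleftrightarrow> conformal (v + w) v w"
proof -
  define P where "P = (\<lambda>(x :: int) (y :: int). (0 \<le> x \<and> 0 \<le> y) \<or> (x \<le> 0 \<and> y \<le> 0))"
  have scale: "P (x * d) (y * d) \<longleftrightarrow> P x y" if "d \<noteq> 0" for x y d
    using that by (cases "d > 0") (auto simp: P_def zero_le_mult_iff mult_le_0_iff)
  have lift: "P (bouquet_lift c v $ i) (bouquet_lift c w $ i) \<longleftrightarrow> P (v $ k) (w $ k)"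
    if "i \<in> B k" for i k
    using that scale enumerated_support[of k] by (auto simp: bouquet_lift_nth[OF that] support_def)
  have "(\<forall>i. P (bouquet_lift c v $ i) (bouquet_lift c w $ i)) \<longleftrightarrow> (\<forall>k. P (v $ k) (w $ k))"
    using lift in_some_enumerated_bouquet enumerated_bouquet_member by metis
  then show ?thesis
    by (simp add: conformal_iff_conformal_on_UNIV conformal_on_iff_same_sign bouquet_lift_add P_def)
qed

text \<open>A negative entry of \<open>c k\<close> turns the condition of semiconformality on the \<open>k\<close>-th coordinate
  into its mirror image. A mixed bouquet has entries of both signs, and the condition together with
  its mirror image is conformality; a non-mixed one has only positive entries, and on the free bouquet
  kernel vectors vanish.\<close>

lemma semiconformal_bouquet_lift_iff:
  assumes vw: "v \<in> int_kernel (bouquet_matrix A c)" "w \<in> int_kernel (bouquet_matrix A c)"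
  shows "semiconformal (bouquet_lift c v) (bouquet_lift c w) \<longleftrightarrow>
    semiconformal v w \<and> conformal_on {k. mixed_bouquet A (B k)} (v + w) v w"
proof -
  define P where "P = (\<lambda>(x :: int) (y :: int). (x > 0 \<longrightarrow> y \<ge> 0) \<and> (y < 0 \<longrightarrow> x \<le> 0))"
  define Q where "Q = (\<lambda>(x :: int) (y :: int). (0 \<le> x \<and> 0 \<le> y) \<or> (x \<le> 0 \<and> y \<le> 0))"
  have P_pos: "P (x * d) (y * d) \<longleftrightarrow> P x y" if "d > 0" for x y d
    using that by (simp add: P_def zero_less_mult_iff zero_le_mult_iff mult_less_0_iff mult_le_0_iff)
  have P_neg: "P (x * d) (y * d) \<longleftrightarrow> P (- x) (- y)" if "d < 0" for x y d
    using P_pos[of "- d" "- x" "- y"] that by simp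
  have both: "P x y \<and> P (- x) (- y) \<longleftrightarrow> Q x y" for x y
    by (auto simp: P_def Q_def)
  have lift: "(\<forall>i\<in>B k. P (bouquet_lift c v $ i) (bouquet_lift c w $ i)) \<longleftrightarrow>
      P (v $ k) (w $ k) \<and> (mixed_bouquet A (B k) \<longrightarrow> Q (v $ k) (w $ k))" for k
  proof -
    have eq: "(\<forall>i\<in>B k. P (bouquet_lift c v $ i) (bouquet_lift c w $ i)) \<longleftrightarrow>
        (\<forall>i\<in>B k. P (v $ k * c k $ i) (w $ k * c k $ i))"
      by (simp add: bouquet_lift_nth)
    obtain i where i: "i \<in> B k"
      by (rule enumerated_bouquet_member)
    consider "free_bouquet A (B k)" | "\<not> free_bouquet A (B k)" "\<not> mixed_bouquet A (B k)"
      | "mixed_bouquet A (B k)"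
      by blast
    then show ?thesis
    proof cases
      case 1
      then show ?thesis
        unfolding eq using kernel_zero_on_free_bouquet vw by (simp add: P_def Q_def)
    next
      case 2
      then have "\<forall>i\<in>B k. c k $ i > 0"
        using nonmixed_bouquet_vector_positive[OF basis enumerated_bouquet _ vecs] by blast
      then show ?thesis
        unfolding eq using i P_pos 2 by auto
    next
      case 3
      then obtain i j where ij: "i \<in> B k" "c k $ i > 0" "j \<in> B k" "c k $ j < 0"
        using mixed_bouquet_vector_both_signs[OF basis _ vecs] by blast
      have "c k $ l > 0 \<or> c k $ l < 0" if "l \<in> B k" for l
      proof -
        have "l \<in> support (c k)"
          using that by (simp add: enumerated_support)
        then show ?thesis
          by (auto simp: support_def)
      qed
      then have "(\<forall>l\<in>B k. P (v $ k * c k $ l) (w $ k * c k $ l)) \<longleftrightarrow>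
          P (v $ k) (w $ k) \<and> P (- (v $ k)) (- (w $ k))"
        using ij P_pos P_neg by metis
      then show ?thesis
        unfolding eq using 3 both by blast
    qed
  qed
  have "(\<forall>i. P (bouquet_lift c v $ i) (bouquet_lift c w $ i)) \<longleftrightarrow>
      (\<forall>k. \<forall>i\<in>B k. P (bouquet_lift c v $ i) (bouquet_lift c w $ i))"
    using in_some_enumerated_bouquet by blast
  then have "(\<forall>i. P (bouquet_lift c v $ i) (bouquet_lift c w $ i)) \<longleftrightarrow>
      (\<forall>k. P (v $ k) (w $ k)) \<and> (\<forall>k. mixed_bouquet A (B k) \<longrightarrow> Q (v $ k) (w $ k))"
    by (simp only: lift all_conj_distrib)
  then show ?thesis
    by (simp add: semiconformal_def conformal_on_iff_same_sign P_def Q_def)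
qed

lemma proper_decomposition_bouquet_lift_iff:
  "proper_decomposition A (bouquet_lift c u) (bouquet_lift c v) (bouquet_lift c w) \<longleftrightarrow>
    proper_decomposition (bouquet_matrix A c) u v w"
  using bouquet_lift_eq_iff[of u "v + w"] bouquet_lift_eq_iff[of v 0] bouquet_lift_eq_iff[of w 0]
  by (simp add: proper_decomposition_def decomposition_def bouquet_lift_in_kernel_iff
      bouquet_lift_add bouquet_lift_zero)

lemma ex_proper_decomposition_bouquet_lift_iff:
  "(\<exists>x y. proper_decomposition A (bouquet_lift c u) x y \<and> R x y) \<longleftrightarrow>
    (\<exists>v w. proper_decomposition (bouquet_matrix A c) u v w \<and> R (bouquet_lift c v) (bouquet_lift c w))"
proof -
  have "\<exists>v. bouquet_lift c v = x" if "x \<in> int_kernel A" for x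
    using bouquet_lift_surj[OF that] by blast
  then show ?thesis
    by (metis proper_decomposition_bouquet_lift_iff proper_decomposition_def decomposition_def)
qed

lemma bouquet_lift_in_graver_basis_iff:
  "bouquet_lift c u \<in> graver_basis A \<longleftrightarrow> u \<in> graver_basis (bouquet_matrix A c)"
proof -
  have "proper_decomposition (bouquet_matrix A c) u v w \<and>
        conformal (bouquet_lift c u) (bouquet_lift c v) (bouquet_lift c w) \<longleftrightarrow>
      proper_decomposition (bouquet_matrix A c) u v w \<and> conformal u v w" for v w
    using conformal_bouquet_lift_iff[of v w]
    by (auto simp: proper_decomposition_def decomposition_def)
  then have "(\<exists>x y. proper_decomposition A (bouquet_lift c u) x y \<and> conformal (bouquet_lift c u) x y) \<longleftrightarrow>
      (\<exists>v w. proper_decomposition (bouquet_matrix A c) u v w \<and> conformal u v w)"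
    by (simp only: ex_proper_decomposition_bouquet_lift_iff)
  moreover have "bouquet_lift c u = 0 \<longleftrightarrow> u = 0"
    using bouquet_lift_eq_iff[of u 0] by (simp add: bouquet_lift_zero)
  ultimately show ?thesis
    by (simp only: graver_basis_def mem_Collect_eq bouquet_lift_in_kernel_iff)
qed

lemma semiconformally_decomposable_bouquet_lift_iff:
  "semiconformally_decomposable {} A (bouquet_lift c u) \<longleftrightarrow>
    semiconformally_decomposable {k. mixed_bouquet A (B k)} (bouquet_matrix A c) u"
proof -
  have "proper_decomposition (bouquet_matrix A c) u v w \<and>
        semiconformal (bouquet_lift c v) (bouquet_lift c w) \<longleftrightarrow>
      proper_decomposition (bouquet_matrix A c) u v w \<and>
        semiconformal v w \<and> conformal_on {k. mixed_bouquet A (B k)} u v w" for v w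
    using semiconformal_bouquet_lift_iff[of v w]
    by (auto simp: proper_decomposition_def decomposition_def)
  then show ?thesis
    unfolding semiconformally_decomposable_empty_iff ex_proper_decomposition_bouquet_lift_iff
    unfolding semiconformally_decomposable_def by (simp only:)
qed

lemma graver_basis_indecomposable_bouquet_iff:
  "(\<forall>u\<in>graver_basis A. \<not> semiconformally_decomposable {} A u) \<longleftrightarrow>
    (\<forall>u\<in>graver_basis (bouquet_matrix A c).
      \<not> semiconformally_decomposable {k. mixed_bouquet A (B k)} (bouquet_matrix A c) u)"
proof -
  have "graver_basis A = bouquet_lift c ` graver_basis (bouquet_matrix A c)"
  proof
    show "graver_basis A \<subseteq> bouquet_lift c ` graver_basis (bouquet_matrix A c)"
    proof
      fix z assume z: "z \<in> graver_basis A"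
      then have "z \<in> int_kernel A"
        by (simp add: graver_basis_def)
      then obtain u where "bouquet_lift c u = z"
        using bouquet_lift_surj by blast
      then show "z \<in> bouquet_lift c ` graver_basis (bouquet_matrix A c)"
        using z bouquet_lift_in_graver_basis_iff by blast
    qed
  qed (use bouquet_lift_in_graver_basis_iff in blast)
  then show ?thesis
    by (simp add: semiconformally_decomposable_bouquet_lift_iff)
qed

end


section \<open>The S-Lawrence property\<close>

text \<open>The decompositions \<open>u = v + w\<close> that are semiconformal correspond to the elements
  \<open>t = u\<^sup>+ - v\<close> of the fiber of \<open>u\<^sup>+\<close>, with \<open>v = 0\<close> for \<open>t = u\<^sup>+\<close> and \<open>w = 0\<close> for \<open>t = u\<^sup>-\<close>;
  conformality on the coordinate \<open>i\<close> says that \<open>t\<^sub>i\<close> is at most \<open>\<bar>u\<^sub>i\<bar>\<close>.\<close>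

lemma semiconformally_decomposable_iff_fiber:
  fixes C :: "int^'s::finite^'m"
  assumes u: "u \<in> int_kernel C"
  shows "semiconformally_decomposable S C u \<longleftrightarrow>
    (\<exists>t\<in>fiber C (pos_part u). t \<noteq> pos_part u \<and> t \<noteq> neg_part u \<and>
      (\<forall>i\<in>S. t $ i \<in> {0..max (pos_part u $ i) (neg_part u $ i)}))"
proof
  assume "semiconformally_decomposable S C u"
  then obtain v w where vw: "v \<in> int_kernel C" "u = v + w" "v \<noteq> 0" "w \<noteq> 0" "semiconformal v w"
      "conformal_on S u v w"
    unfolding semiconformally_decomposable_def proper_decomposition_def decomposition_def by blast
  define t :: "nat^'s" where "t = (\<chi> i. nat (int (pos_part u $ i) - v $ i))"
  have "v $ i \<le> int (pos_part u $ i)" for i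
  proof -
    have "pos_part v $ i \<le> pos_part u $ i"
      using vw(5) by (simp add: semiconformal_iff_parts_le[OF vw(2)] less_eq_vec_def)
    then show ?thesis
      by (simp only: pos_part_def vec_lambda_beta nat_le_iff)
  qed
  then have t: "int (t $ i) = int (pos_part u $ i) - v $ i" for i
    by (simp add: t_def)
  show "\<exists>t\<in>fiber C (pos_part u). t \<noteq> pos_part u \<and> t \<noteq> neg_part u \<and>
      (\<forall>i\<in>S. t $ i \<in> {0..max (pos_part u $ i) (neg_part u $ i)})"
  proof (intro bexI conjI)
    have "(\<chi> i. int (pos_part u $ i) - int (t $ i)) = v"
      by (simp add: t vec_eq_iff)
    then show "t \<in> fiber C (pos_part u)"
      using vw(1) by (simp add: fiber_iff)
    show "t \<noteq> pos_part u"
    proof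
      assume "t = pos_part u"
      then have "v $ i = 0" for i
        using t[of i] by simp
      then show False
        using vw(3) by (simp add: vec_eq_iff)
    qed
    show "t \<noteq> neg_part u"
    proof
      assume "t = neg_part u"
      then have "w $ i = 0" for i
        using t[of i] int_pos_part_minus_neg_part[of u i] by (simp add: vw(2))
      then show False
        using vw(4) by (simp add: vec_eq_iff)
    qed
    show "\<forall>i\<in>S. t $ i \<in> {0..max (pos_part u $ i) (neg_part u $ i)}"
    proof
      fix i assume "i \<in> S"
      then have "0 \<le> v $ i \<and> 0 \<le> w $ i \<or> v $ i \<le> 0 \<and> w $ i \<le> 0"
        using vw(6) by (simp add: conformal_on_iff_same_sign[OF vw(2)])
      then show "t $ i \<in> {0..max (pos_part u $ i) (neg_part u $ i)}"
        using t[of i] by (auto simp: pos_part_def neg_part_def vw(2) split: if_splits)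
    qed
  qed
next
  assume "\<exists>t\<in>fiber C (pos_part u). t \<noteq> pos_part u \<and> t \<noteq> neg_part u \<and>
      (\<forall>i\<in>S. t $ i \<in> {0..max (pos_part u $ i) (neg_part u $ i)})"
  then obtain t where t: "t \<in> fiber C (pos_part u)" "t \<noteq> pos_part u" "t \<noteq> neg_part u"
    "\<forall>i\<in>S. t $ i \<le> max (pos_part u $ i) (neg_part u $ i)"
    by auto
  define v where "v = (\<chi> i. int (pos_part u $ i) - int (t $ i))"
  have v_nth: "v $ i = int (nat (u $ i)) - int (t $ i)" for i
    by (simp add: v_def pos_part_def)
  have "v \<in> int_kernel C"
    using t(1) by (simp add: v_def fiber_iff)
  moreover have "v \<noteq> 0"
    using t(2) by (auto simp: v_def vec_eq_iff intro: sym)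
  moreover have "u - v \<noteq> 0"
  proof
    assume "u - v = 0"
    then have "t $ i = neg_part u $ i" for i
      using int_pos_part_minus_neg_part[of u i] by (simp add: v_def vec_eq_iff)
    then show False
      using t(3) by (simp add: vec_eq_iff)
  qed
  ultimately have "proper_decomposition C u v (u - v)"
    using u by (simp add: proper_decomposition_def decomposition_def diff_in_kernel)
  moreover have "semiconformal v (u - v)"
    by (auto simp: semiconformal_def v_nth)
  moreover have "conformal_on S u v (u - v)"
  proof -
    have "0 \<le> v $ i \<and> 0 \<le> (u - v) $ i \<or> v $ i \<le> 0 \<and> (u - v) $ i \<le> 0" if "i \<in> S" for i
    proof -
      have "t $ i \<le> max (nat (u $ i)) (nat (- (u $ i)))"
        using t(4) that by (simp add: pos_part_def neg_part_def)
      then show ?thesis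
        by (auto simp: v_nth)
    qed
    then show ?thesis
      by (subst conformal_on_iff_same_sign) auto
  qed
  ultimately show "semiconformally_decomposable S C u"
    unfolding semiconformally_decomposable_def by blast
qed

lemma S_Lawrence_iff_indecomposable:
  fixes C :: "int^'s::finite^'m"
  shows "S_Lawrence S C \<longleftrightarrow> (\<forall>u\<in>graver_basis C. \<not> semiconformally_decomposable S C u)"
  unfolding S_Lawrence_def
  using semiconformally_decomposable_iff_fiber[of _ C S] by (simp add: graver_basis_def)

theorem theoremD:
  fixes A :: "int^'n::{finite,linorder}^'m::finite"
    and Gs :: "(int^'n::{finite,linorder}) list"
    and B :: "'s::finite \<Rightarrow> 'n set"
    and c :: "'s \<Rightarrow> int^'n::{finite,linorder}"
    and A\<^sub>B :: "int^'s^'m"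
    and S :: "'s set"
  assumes gale_basis: "lattice_basis (int_kernel A) Gs"
    and bouquet_enum: "bij_betw B UNIV (bouquets A)"
    and bouquet_vecs: "\<And>k. is_bouquet_vector A Gs (B k) (c k)"
    and A\<^sub>B: "A\<^sub>B = bouquet_matrix A c"
    and S: "S = {k. mixed_bouquet A (B k)}"
  shows "((\<not> (\<exists>u\<in>graver_basis A\<^sub>B. \<exists>v w. proper_decomposition A\<^sub>B u v w \<and>
                semiconformal v w \<and> conformal_on S u v w))
            \<longleftrightarrow> strongly_robust TYPE('k::field) A) \<and>
         (strongly_robust TYPE('k) A \<longleftrightarrow> bases_coincide TYPE('k) A) \<and>
         (strongly_robust TYPE('k) A \<longleftrightarrow> S_Lawrence S A\<^sub>B)"
proof -
  have "strongly_robust TYPE('k) A \<longleftrightarrow>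
      (\<forall>u\<in>graver_basis A\<^sub>B. \<not> semiconformally_decomposable S A\<^sub>B u)"
    using graver_basis_indecomposable_bouquet_iff[OF gale_basis bouquet_enum bouquet_vecs]
    by (simp add: strongly_robust_iff_indecomposable A\<^sub>B S)
  then show ?thesis
    by (simp add: bases_coincide_iff_strongly_robust S_Lawrence_iff_indecomposable
        semiconformally_decomposable_def)
qed

end
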